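(* Assume the stability condition, condition (C), $\rho_1\ne\rho_2$, Assumption (E), the span condition (S), Assumption (F), and $\bm 1\in\mathrm{Span}(\bm d_2,\bm e_2,\dots,\bm e_{|\mathcal M|})$, where $\bm 1\in\mathbb R^{\mathcal M}$ is the all-ones vector (see context). Then there exist vectors $\bm b_{2,j}\in\mathbb R^{m_j}$, $j=2,\dots,|\mathcal M|$, and $\bm b_2\in\mathbb R^{|\mathcal M|}$ such that the functions $$\mathfrak h_{\rho_{2,j}}\doteq[(\rho_{2,j},1,\bm e_j),\cdot]+\sum_{l=1}^{m_j}\bm b_{2,j}(l)[(\rho_{2,j},\alpha^*_{j,l},\bm e_{j,l}),\cdot],\quad j=2,\dots,|\mathcal M|,$$ and $$\mathfrak h\doteq\bm b_2(1)\,\mathfrak h_{\rho_2}+\sum_{j=2}^{|\mathcal M|}\bm b_2(j)\,\mathfrak h_{\rho_{2,j}}$$ are all $(Y,M)$-harmonic and $\partial B$-determined; furthermore $\lim_{k\to\infty}\mathfrak h((k,k),m)=1$ for all $m\in\mathcal M$.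
   Context: Setting: $\mathcal M$ is a finite set, $\bm P$ an irreducible aperiodic transition matrix on $\mathcal M$ with stationary distribution $\bm\pi$; for each $m\in\mathcal M$, $\lambda(m),\mu_1(m),\mu_2(m)>0$ and $\lambda(m)+\mu_1(m)+\mu_2(m)=1$. $(Y,M)$ is the Markov chain on $\mathbb Z\times\mathbb Z_+\times\mathcal M$ which from $(y,m)$ moves to $(y,m')$ with probability $\bm P(m,m')$ for each $m'\neq m$, and with probability $\bm P(m,m)$ keeps $m$ and attempts an increment $v\in\{(-1,0),(1,1),(0,-1)\}$, chosen with respective probabilities $\lambda(m),\mu_1(m),\mu_2(m)$: it moves to $(y+v,m)$ if $y+v\in\mathbb Z\times\mathbb Z_+$ and otherwise stays. A function $h$ on $\mathbb Z\times\mathbb Z_+\times\mathcal M$ is $(Y,M)$-harmonic if $\mathbb E_{(y,m)}[h(Y_1,M_1)]=h(y,m)$ for all $(y,m)\in\mathbb Z\times\mathbb Z_+\times\mathcal M$. $\partial B=\{y\in\mathbb Z\times\mathbb Z_+:y(1)=y(2)\}$ is the exit boundary of $B=\{y\in\mathbb Z\times\mathbb Z_+:y(1)\ge y(2)\}$, and $\tau=\inf\{k\ge0:Y_k\in\partial B\}$. A $(Y,M)$-harmonic function is $\partial B$-determined if it is of the form $(y,m)\mapsto\mathbb E_{(y,m)}[f(Y_\tau,M_\tau)1_{\{\tau<\infty\}}]$ for some function $f$. $[(\beta,\alpha,\bm d),(y,m)]=\beta^{y(1)-y(2)}\alpha^{y(2)}\bm d(m)$. For nonzero $\beta,\alpha\in\mathbb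 C$, $\bm A(\beta,\alpha)$ is the $\mathcal M\times\mathcal M$ matrix with off-diagonal entries $\bm P(m_1,m_2)$ and diagonal entries $\bm P(m,m)\big(\lambda(m)/\beta+\mu_1(m)\alpha+\mu_2(m)\beta/\alpha\big)$; for $\beta,\alpha>0$, $\Lambda_1(\beta,\alpha)$ is its largest (Perron–Frobenius) eigenvalue. $\bm c(\beta,\alpha,\bm d)(m)=\bm P(m,m)\mu_2(m)\bm d(m)(1-\beta/\alpha)$, $m\in\mathcal M$. Points $(\beta,\alpha)$ and $(\beta,\alpha')$ with the same $\beta$ are conjugate if $\det(\bm I-\bm A(\beta,\alpha))=\det(\bm I-\bm A(\beta,\alpha'))=0$, where $\bm I$ is the identity matrix. Stability condition: $\sum_{m}(\lambda(m)-\mu_i(m))\bm\pi(m)\bm P(m,m)<0$, $i=1,2$. Under it $\rho_1$ is the unique number in $(0,1)$ with $\Lambda_1(\rho_1,\rho_1)=1$, and $\rho_2$ the unique number in $(0,1)$ with $\Lambda_1(\rho_2,1)=1$; $\bm d_2$ is an eigenvector of $\bm A(\rho_2,1)$ for the eigenvalue $1$ with strictly positive entries. Condition (C): $\sum_{m}(\rho_2\mu_2(m)-\mu_1(m))\bm P(m,m)\det\big((\bm I-\bm A(\rho_2,1))^{m,m}\big)<0$, where $G^{m,m}$ is $G$ with row and column $m$ removed. Under it there is a unique $\alpha_1^*\in(0,1)$ with $\Lambda_1(\rho_2,\alpha_1^* )=1$. Assumption (E): for all $\beta,\alpha>0$ the matrix $\bm A(\beta,\alpha)$ has $|\mathcal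 M|$ distinct real eigenvalues, labelled $\Lambda_1>\Lambda_2>\dots>\Lambda_{|\mathcal M|}$. For $j=2,\dots,|\mathcal M|$, $\alpha_j^*\in(0,\alpha_1^* )$ is a number with $\Lambda_j(\rho_2,\alpha_j^* )=1$ (such numbers exist); for $j=1,\dots,|\mathcal M|$, $\bm d_{2,j}\in\mathbb R^{\mathcal M}\setminus\{0\}$ satisfies $\bm A(\rho_2,\alpha_j^* )\bm d_{2,j}=\bm d_{2,j}$. Span condition (S): $\bm c(\rho_2,1,\bm d_2)\in\mathrm{Span}\big(\bm c(\rho_2,\alpha_j^*,\bm d_{2,j}):j=1,\dots,|\mathcal M|\big)$. Under these assumptions there is $\bm b_{2,1}\in\mathbb R^{|\mathcal M|}$ such that $\mathfrak h_{\rho_2}=[(\rho_2,1,\bm d_2),\cdot]+\sum_{j=1}^{|\mathcal M|}\bm b_{2,1}(j)[(\rho_2,\alpha_j^*,\bm d_{2,j}),\cdot]$ is $(Y,M)$-harmonic and $\partial B$-determined; $\mathfrak h_{\rho_2}$ denotes this function for a fixed such $\bm b_{2,1}$. The numbers $\rho_2>\rho_{2,2}>\rho_{2,3}>\dots>\rho_{2,|\mathcal M|}>0$ and nonzero vectors $\bm e_2,\dots,\bm e_{|\mathcal M|}\in\mathbb R^{\mathcal M}$ are such that $\bm A(\rho_{2,j},1)\bm e_j=\bm e_j$ for $j=2,\dots,|\mathcal M|$ (they exist under the stability condition and Assumption (E)). Assumption (F): for each $j=2,\dots,|\mathcal M|$ there are $m_j\le|\mathcal M|$ conjugate points $(\rho_{2,j},\alpha^*_{j,l})$,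 $l=1,\dots,m_j$, of $(\rho_{2,j},1)$ and nonzero vectors $\bm e_{j,l}\in\mathbb R^{\mathcal M}$ such that $|\alpha^*_{j,l}|<1$ and $\bm A(\rho_{2,j},\alpha^*_{j,l})\bm e_{j,l}=\bm e_{j,l}$ for $l=1,\dots,m_j$, and $\bm c(\rho_{2,j},1,\bm e_j)\in\mathrm{Span}\big(\bm c(\rho_{2,j},\alpha^*_{j,l},\bm e_{j,l}):l=1,\dots,m_j\big)$. The functions in the claim use these points and vectors.
   Formalization: ∂B-determined is required only for starting points y in B (y(1) ≥ y(2)); on all of Z×Z_+ it fails, since the functions are bounded on ∂B but unbounded where y(1) < y(2). Harmonicity is still claimed on all of Z×Z_+×M. *)

theory Defs
  imports "HOL-Probability.Probability"
begin

section \<open>Markov chains on a countable state space\<close>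

text \<open>Transition kernels of the chain started at \<open>x\<close>: coordinate \<open>0\<close> is \<open>x\<close>, coordinate
  \<open>Suc n\<close> is drawn from \<open>K\<close> at coordinate \<open>n\<close>.\<close>

fun chain_kernel :: "('s \<Rightarrow> 's pmf) \<Rightarrow> 's \<Rightarrow> nat \<Rightarrow> (nat \<Rightarrow> 's) \<Rightarrow> 's measure" where
  "chain_kernel K x 0 \<omega> = return (count_space UNIV) x"
| "chain_kernel K x (Suc n) \<omega> = measure_pmf (K (\<omega> n))"

text \<open>The law on path space \<open>nat \<Rightarrow> 's\<close> given by the Ionescu-Tulcea theorem.\<close>

definition path_law :: "('s \<Rightarrow> 's pmf) \<Rightarrow> 's \<Rightarrow> (nat \<Rightarrow> 's) measure" where
  "path_law K x =
     projective_family.lim UNIV (Ionescu_Tulcea.CI (chain_kernel K x) (\<lambda>_. count_space UNIV))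
       (\<lambda>_. count_space UNIV)"

lemma Ionescu_Tulcea_chain:
  fixes K :: "'s \<Rightarrow> 's pmf"
  shows "Ionescu_Tulcea (chain_kernel K x) (\<lambda>_. count_space UNIV)"
proof (rule Ionescu_Tulcea.intro)
  fix i :: nat
  show "chain_kernel K x i \<in> Pi\<^sub>M {0..<i} (\<lambda>_. count_space UNIV) \<rightarrow>\<^sub>M subprob_algebra (count_space UNIV)"
  proof (cases i)
    case 0
    have "return (count_space UNIV) x \<in> space (subprob_algebra (count_space UNIV))"
      by (rule measurable_space[OF return_measurable]) simp
    moreover have "chain_kernel K x i = (\<lambda>_. return (count_space UNIV) x)"
      using 0 by (simp add: fun_eq_iff)
    ultimately show ?thesis by (simp only: measurable_const)
  next
    case (Suc n)
    have "(\<lambda>\<omega>. \<omega> n) \<in> Pi\<^sub>M {0..<i} (\<lambda>_. count_space UNIV) \<rightarrow>\<^sub>M count_space UNIV"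
      using Suc by (intro measurable_component_singleton) simp
    moreover have "(\<lambda>s. measure_pmf (K s)) \<in> count_space UNIV \<rightarrow>\<^sub>M subprob_algebra (count_space UNIV)"
      by (auto simp: space_subprob_algebra intro!: prob_space_imp_subprob_space measure_pmf.prob_space_axioms)
    ultimately show ?thesis
      unfolding Suc chain_kernel.simps by (rule measurable_compose)
  qed
next
  fix i :: nat and \<omega> :: "nat \<Rightarrow> 's"
  show "prob_space (chain_kernel K x i \<omega>)"
    by (cases i) (auto intro!: prob_space_return measure_pmf.prob_space_axioms)
qed

text \<open>Finite-dimensional distributions of \<^const>\<open>path_law\<close>.\<close>

lemma emeasure_path_law_cylinder:
  "emeasure (path_law K x) {\<omega>. \<forall>i\<le>n. \<omega> i = s i} =
     (if s 0 = x then \<Prod>i<n. ennreal (pmf (K (s i)) (s (Suc i))) else 0)"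
proof -
  interpret IT: Ionescu_Tulcea "chain_kernel K x" "\<lambda>_. count_space UNIV"
    by (rule Ionescu_Tulcea_chain)
  let ?M = "\<lambda>_::nat. count_space (UNIV :: 'a set)"
  have cyl: "PiE {0..<Suc k} (\<lambda>i. {s i}) \<in> sets (PiM {0..<Suc k} ?M)" for k
    by (rule sets_PiM_I_finite) auto
  have sp: "PiE {0..<Suc k} (\<lambda>i. {s i}) = {restrict s {0..<Suc k}}" for k
    by (auto simp: PiE_eq_singleton)
  have sg: "{restrict s {0..<Suc k}} \<in> sets (PiM {0..<Suc k} ?M)" for k
    using cyl sp by metis
  have C: "emeasure (IT.C 0 (Suc k) (\<lambda>_. undefined)) {restrict s {0..<Suc k}} =
      (if s 0 = x then \<Prod>i<k. ennreal (pmf (K (s i)) (s (Suc i))) else 0)" for k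
  proof (induction k)
    case 0
    have u: "(\<lambda>_. undefined) \<in> space (PiM {0..<0} ?M)" by (simp add: space_PiM)
    have m: "IT.eP 0 \<in> measurable (PiM {0..<0} ?M) (subprob_algebra (PiM {0..<Suc 0} ?M))"
      by (rule IT.measurable_eP)
    have "emeasure (IT.C 0 (Suc 0) (\<lambda>_. undefined)) {restrict s {0..<Suc 0}}
        = emeasure (IT.eP 0 (\<lambda>_. undefined)) {restrict s {0..<Suc 0}}"
      using bind_return[OF m u] by simp
    also have "\<dots> = emeasure (chain_kernel K x 0 (\<lambda>_. undefined))
        ((\<lambda>t. fun_upd (\<lambda>_. undefined) 0 t) -` {restrict s {0..<Suc 0}} \<inter> space (?M 0))"
      by (rule IT.emeasure_eP[OF u sg])
    also have "(\<lambda>t. fun_upd (\<lambda>_. undefined) 0 t) -` {restrict s {0..<Suc 0}} \<inter> space (?M 0) = {s 0}"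
      by (auto simp: fun_eq_iff restrict_def split: if_splits)
    finally show ?case by (simp add: indicator_def)
  next
    case (Suc k)
    let ?N = "IT.C 0 (Suc k) (\<lambda>_. undefined)"
    have u: "(\<lambda>_. undefined) \<in> space (PiM {0..<0} ?M)" by (simp add: space_PiM)
    have sN: "sets ?N = sets (PiM {0..<Suc k} ?M)" using IT.sets_C[OF u, of "Suc k"] by simp
    have spN: "space ?N = space (PiM {0..<Suc k} ?M)" using sN by (rule sets_eq_imp_space_eq)
    have ne: "space ?N \<noteq> {}"
      using spN by (auto simp: space_PiM)
    have m: "IT.eP (Suc k) \<in> measurable ?N (subprob_algebra (PiM {0..<Suc (Suc k)} ?M))"
      using IT.measurable_eP[of "Suc k"] measurable_cong_sets[OF sN refl] by blast
    have "emeasure (IT.C 0 (Suc (Suc k)) (\<lambda>_. undefined)) {restrict s {0..<Suc (Suc k)}}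
       = emeasure (?N \<bind> IT.eP (Suc k)) {restrict s {0..<Suc (Suc k)}}" by simp
    also have "\<dots> = (\<integral>\<^sup>+ w. emeasure (IT.eP (Suc k) w) {restrict s {0..<Suc (Suc k)}} \<partial>?N)"
      by (rule emeasure_bind[OF ne m sg])
    also have "\<dots> = (\<integral>\<^sup>+ w. ennreal (pmf (K (s k)) (s (Suc k))) *
        indicator {restrict s {0..<Suc k}} w \<partial>?N)"
    proof (rule nn_integral_cong)
      fix w assume "w \<in> space ?N"
      then have w: "w \<in> space (PiM {0..<Suc k} ?M)" using spN by simp
      have "emeasure (IT.eP (Suc k) w) {restrict s {0..<Suc (Suc k)}} =
         emeasure (chain_kernel K x (Suc k) w)
        ((\<lambda>t. fun_upd w (Suc k) t) -` {restrict s {0..<Suc (Suc k)}} \<inter> space (?M (Suc k)))"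
        by (rule IT.emeasure_eP[OF w sg])
      also have "(\<lambda>t. fun_upd w (Suc k) t) -` {restrict s {0..<Suc (Suc k)}} \<inter> space (?M (Suc k)) =
         (if w = restrict s {0..<Suc k} then {s (Suc k)} else {})"
      proof -
        have wext: "w i = undefined" if "i \<notin> {0..<Suc k}" for i
          using w that by (auto simp: space_PiM PiE_def extensional_def)
        have "fun_upd w (Suc k) t = restrict s {0..<Suc (Suc k)} \<longleftrightarrow>
            w = restrict s {0..<Suc k} \<and> t = s (Suc k)" for t
        proof
          assume e: "fun_upd w (Suc k) t = restrict s {0..<Suc (Suc k)}"
          have "w i = restrict s {0..<Suc k} i" for i
            using fun_cong[OF e, of i] wext[of i] by (auto simp: restrict_def split: if_splits)
          moreover have "t = s (Suc k)" using fun_cong[OF e, of "Suc k"] by simp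
          ultimately show "w = restrict s {0..<Suc k} \<and> t = s (Suc k)" by auto
        next
          assume "w = restrict s {0..<Suc k} \<and> t = s (Suc k)"
          then show "fun_upd w (Suc k) t = restrict s {0..<Suc (Suc k)}"
            by (auto simp: fun_eq_iff restrict_def)
        qed
        then show ?thesis by auto
      qed
      finally have eq: "emeasure (IT.eP (Suc k) w) {restrict s {0..<Suc (Suc k)}} =
        emeasure (measure_pmf (K (w k))) (if w = restrict s {0..<Suc k} then {s (Suc k)} else {})"
        by (simp only: chain_kernel.simps)
      show "emeasure (IT.eP (Suc k) w) {restrict s {0..<Suc (Suc k)}} =
        ennreal (pmf (K (s k)) (s (Suc k))) * indicator {restrict s {0..<Suc k}} w"
        unfolding eq by (cases "w = restrict s {0..<Suc k}") (simp_all add: emeasure_pmf_single)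
    qed
    also have "\<dots> = ennreal (pmf (K (s k)) (s (Suc k))) * emeasure ?N {restrict s {0..<Suc k}}"
      by (rule nn_integral_cmult_indicator) (use sg sN in simp)
    finally have step: "emeasure (IT.C 0 (Suc (Suc k)) (\<lambda>_. undefined)) {restrict s {0..<Suc (Suc k)}}
       = ennreal (pmf (K (s k)) (s (Suc k))) * emeasure ?N {restrict s {0..<Suc k}}" .
    show ?case
      unfolding step Suc.IH by (simp add: mult.commute)
  qed
  have eq: "{\<omega>. \<forall>i\<le>n. \<omega> i = s i} = prod_emb UNIV ?M {0..<Suc n} {restrict s {0..<Suc n}}"
    by (auto simp: prod_emb_def fun_eq_iff restrict_def less_Suc_eq_le split: if_splits)
  show ?thesis
    unfolding path_law_def eq IT.lim[OF finite_atLeastLessThan sg]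
    by (subst IT.emeasure_CI[OF subset_refl sg])
       (use C[of n] in \<open>simp add: prod_emb_id space_PiM sets.sets_into_space[OF sg]\<close>)
qed


section \<open>The modulated constrained walk\<close>

type_synonym 'm state = "(int \<times> nat) \<times> 'm"

definition incr_pmf :: "('m \<Rightarrow> real) \<Rightarrow> ('m \<Rightarrow> real) \<Rightarrow> ('m \<Rightarrow> real) \<Rightarrow> 'm \<Rightarrow> (int \<times> int) pmf" where
  "incr_pmf lam \<mu>\<^sub>1 \<mu>\<^sub>2 m =
     pmf_of_list [((-1, 0), lam m), ((1, 1), \<mu>\<^sub>1 m), ((0, -1), \<mu>\<^sub>2 m)]"

definition move :: "int \<times> nat \<Rightarrow> int \<times> int \<Rightarrow> int \<times> nat" where
  "move y v =
     (if int (snd y) + snd v \<ge> 0 then (fst y + fst v, nat (int (snd y) + snd v)) else y)"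

fun YM_step :: "real^'m^'m \<Rightarrow> ('m \<Rightarrow> real) \<Rightarrow> ('m \<Rightarrow> real) \<Rightarrow> ('m \<Rightarrow> real) \<Rightarrow>
    'm::finite state \<Rightarrow> 'm state pmf" where
  "YM_step P lam \<mu>\<^sub>1 \<mu>\<^sub>2 (y, m) =
     bind_pmf (embed_pmf (\<lambda>m'. P $ m $ m'))
       (\<lambda>m'. if m' \<noteq> m then return_pmf (y, m')
             else map_pmf (\<lambda>v. (move y v, m)) (incr_pmf lam \<mu>\<^sub>1 \<mu>\<^sub>2 m))"

definition YM_harmonic :: "real^'m^'m \<Rightarrow> ('m \<Rightarrow> real) \<Rightarrow> ('m \<Rightarrow> real) \<Rightarrow> ('m \<Rightarrow> real) \<Rightarrow>
    ('m::finite state \<Rightarrow> complex) \<Rightarrow> bool" where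
  "YM_harmonic P lam \<mu>\<^sub>1 \<mu>\<^sub>2 h \<longleftrightarrow>
     (\<forall>x. measure_pmf.expectation (YM_step P lam \<mu>\<^sub>1 \<mu>\<^sub>2 x) h = h x)"

definition region_B :: "(int \<times> nat) set" where
  "region_B = {y. fst y \<ge> int (snd y)}"

definition bd_B :: "(int \<times> nat) set" where
  "bd_B = {y. fst y = int (snd y)}"

definition exit_time :: "(nat \<Rightarrow> 'm state) \<Rightarrow> enat" where
  "exit_time \<omega> = Inf {enat k |k. fst (\<omega> k) \<in> bd_B}"

definition exit_value :: "('m state \<Rightarrow> complex) \<Rightarrow> (nat \<Rightarrow> 'm state) \<Rightarrow> complex" where
  "exit_value f \<omega> = (if exit_time \<omega> < \<infinity> then f (\<omega> (the_enat (exit_time \<omega>))) else 0)"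

text \<open>The representation is required for starting points in \<open>region_B\<close>, the set whose exit boundary
  is \<open>bd_B\<close>.  It cannot be asked for on all of \<open>\<int> \<times> \<nat>\<close>: the expectation of bounded boundary data is
  bounded, whereas functions such as \<open>\<beta> powi (y(1) - y(2))\<close> with \<open>0 < \<beta> < 1\<close> are unbounded
  outside \<open>region_B\<close>.\<close>

definition bd_B_determined :: "real^'m^'m \<Rightarrow> ('m \<Rightarrow> real) \<Rightarrow> ('m \<Rightarrow> real) \<Rightarrow> ('m \<Rightarrow> real) \<Rightarrow>
    ('m::finite state \<Rightarrow> complex) \<Rightarrow> bool" where
  "bd_B_determined P lam \<mu>\<^sub>1 \<mu>\<^sub>2 h \<longleftrightarrow>
     (\<exists>f. \<forall>y m. y \<in> region_B \<longrightarrow>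
        integrable (path_law (YM_step P lam \<mu>\<^sub>1 \<mu>\<^sub>2) (y, m)) (exit_value f) \<and>
        h (y, m) = (\<integral>\<omega>. exit_value f \<omega> \<partial>path_law (YM_step P lam \<mu>\<^sub>1 \<mu>\<^sub>2) (y, m)))"


section \<open>Transition matrices\<close>

definition stochastic :: "real^'m^'m \<Rightarrow> bool" where
  "stochastic P \<longleftrightarrow> (\<forall>i j. 0 \<le> P $ i $ j) \<and> (\<forall>i. (\<Sum>j\<in>UNIV. P $ i $ j) = 1)"

text \<open>\<open>^\<close> on \<open>real^'m^'m\<close> would be the componentwise power.\<close>

definition matrix_pow :: "real^'m^'m \<Rightarrow> nat \<Rightarrow> real^'m^'m" where
  "matrix_pow P n = ((**) P ^^ n) (mat 1)"

definition irreducible_matrix :: "real^'m^'m \<Rightarrow> bool" where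
  "irreducible_matrix P \<longleftrightarrow> (\<forall>i j. \<exists>n. 0 < matrix_pow P n $ i $ j)"

definition aperiodic_matrix :: "real^'m^'m \<Rightarrow> bool" where
  "aperiodic_matrix P \<longleftrightarrow> (\<forall>i. Gcd {n. 0 < n \<and> 0 < matrix_pow P n $ i $ i} = 1)"

definition stationary :: "real^'m^'m \<Rightarrow> real^'m \<Rightarrow> bool" where
  "stationary P p \<longleftrightarrow> (\<forall>m. 0 \<le> p $ m) \<and> (\<Sum>m\<in>UNIV. p $ m) = 1 \<and> p v* P = p"

text \<open>Determinant of the square submatrix of \<open>G\<close> with rows and columns indexed by \<open>S\<close>.\<close>

definition det_on :: "'m set \<Rightarrow> 'a::comm_ring_1^'m^'m \<Rightarrow> 'a" where
  "det_on S G = (\<Sum>p | p permutes S. of_int (sign p) * (\<Prod>i\<in>S. G $ i $ p i))"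

lemma det_on_UNIV: "det_on UNIV G = det G"
  by (simp add: det_on_def det_def)

definition real_eigenvalues :: "real^'m^'m \<Rightarrow> real set" where
  "real_eigenvalues G = {x. \<exists>v. v \<noteq> 0 \<and> G *v v = x *s v}"


section \<open>The matrix \<open>A(\<beta>, \<alpha>)\<close> and product-form functions\<close>

text \<open>The scalar type is polymorphic: real points are used for the ordering of eigenvalues, complex
  ones for conjugate points.\<close>

definition A_mat :: "real^'m^'m \<Rightarrow> ('m \<Rightarrow> real) \<Rightarrow> ('m \<Rightarrow> real) \<Rightarrow> ('m \<Rightarrow> real) \<Rightarrow>
    'a::real_field \<Rightarrow> 'a \<Rightarrow> 'a^'m^'m" where
  "A_mat P lam \<mu>\<^sub>1 \<mu>\<^sub>2 \<beta> \<alpha> = (\<chi> i j.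
     if i = j
     then of_real (P $ i $ i) *
       (of_real (lam i) / \<beta> + of_real (\<mu>\<^sub>1 i) * \<alpha> + of_real (\<mu>\<^sub>2 i) * \<beta> / \<alpha>)
     else of_real (P $ i $ j))"

text \<open>The \<open>j\<close>-th largest real eigenvalue, for \<open>j \<ge> 1\<close>.  For positive \<open>\<beta>, \<alpha>\<close> the matrix is
  nonnegative and \<open>j = 1\<close> gives its Perron-Frobenius eigenvalue.\<close>

definition Lam :: "real^'m^'m \<Rightarrow> ('m \<Rightarrow> real) \<Rightarrow> ('m \<Rightarrow> real) \<Rightarrow> ('m \<Rightarrow> real) \<Rightarrow>
    nat \<Rightarrow> real \<Rightarrow> real \<Rightarrow> real" where
  "Lam P lam \<mu>\<^sub>1 \<mu>\<^sub>2 j \<beta> \<alpha> =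
     rev (sorted_list_of_set (real_eigenvalues (A_mat P lam \<mu>\<^sub>1 \<mu>\<^sub>2 \<beta> \<alpha>))) ! (j - 1)"

lemma Lam_1_eq_Max:
  assumes "finite (real_eigenvalues (A_mat P lam \<mu>\<^sub>1 \<mu>\<^sub>2 \<beta> \<alpha>))"
    and "real_eigenvalues (A_mat P lam \<mu>\<^sub>1 \<mu>\<^sub>2 \<beta> \<alpha>) \<noteq> {}"
  shows "Lam P lam \<mu>\<^sub>1 \<mu>\<^sub>2 1 \<beta> \<alpha> = Max (real_eigenvalues (A_mat P lam \<mu>\<^sub>1 \<mu>\<^sub>2 \<beta> \<alpha>))"
proof -
  let ?E = "real_eigenvalues (A_mat P lam \<mu>\<^sub>1 \<mu>\<^sub>2 \<beta> \<alpha>)"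
  let ?l = "sorted_list_of_set ?E"
  have ne: "?l \<noteq> []" using assms by simp
  then have "?l = butlast ?l @ [last ?l]" by simp
  moreover have "sorted ?l" by simp
  ultimately have "\<forall>x\<in>set (butlast ?l). x \<le> last ?l"
    by (metis sorted_append list.set_intros(1))
  moreover have "set ?l = ?E" using assms by simp
  ultimately have "\<forall>x\<in>?E. x \<le> last ?l"
    by (metis \<open>?l = butlast ?l @ [last ?l]\<close> append_is_Nil_conv in_set_butlastD
          in_set_conv_decomp_last order_refl rotate1.simps(2) set_ConsD set_rotate1)
  moreover have "last ?l \<in> ?E" using ne \<open>set ?l = ?E\<close> last_in_set by metis
  ultimately have "Max ?E = last ?l" using assms by (intro Max_eqI) auto
  then show ?thesis using ne by (simp add: Lam_def hd_conv_nth[symmetric] hd_rev)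
qed

definition c_vec :: "real^'m^'m \<Rightarrow> ('m \<Rightarrow> real) \<Rightarrow> 'a::real_field \<Rightarrow> 'a \<Rightarrow> 'a^'m \<Rightarrow> 'a^'m" where
  "c_vec P \<mu>\<^sub>2 \<beta> \<alpha> d = (\<chi> m. of_real (P $ m $ m) * of_real (\<mu>\<^sub>2 m) * d $ m * (1 - \<beta> / \<alpha>))"

definition conjugate_points :: "real^'m^'m \<Rightarrow> ('m \<Rightarrow> real) \<Rightarrow> ('m \<Rightarrow> real) \<Rightarrow> ('m \<Rightarrow> real) \<Rightarrow>
    complex \<Rightarrow> complex \<Rightarrow> complex \<Rightarrow> bool" where
  "conjugate_points P lam \<mu>\<^sub>1 \<mu>\<^sub>2 \<beta> \<alpha> \<alpha>' \<longleftrightarrow> \<beta> \<noteq> 0 \<and> \<alpha> \<noteq> 0 \<and> \<alpha>' \<noteq> 0 \<and>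
     det (mat 1 - A_mat P lam \<mu>\<^sub>1 \<mu>\<^sub>2 \<beta> \<alpha>) = 0 \<and> det (mat 1 - A_mat P lam \<mu>\<^sub>1 \<mu>\<^sub>2 \<beta> \<alpha>') = 0"

definition of_real_vec :: "real^'m \<Rightarrow> complex^'m" where
  "of_real_vec d = (\<chi> m. complex_of_real (d $ m))"

text \<open>The function \<open>[(\<beta>, \<alpha>, d), \<cdot>]\<close>; the exponent \<open>y(1) - y(2)\<close> may be negative.\<close>

fun bracket :: "complex \<Rightarrow> complex \<Rightarrow> real^'m \<Rightarrow> 'm state \<Rightarrow> complex" where
  "bracket \<beta> \<alpha> d (y, m) = \<beta> powi (fst y - int (snd y)) * \<alpha> ^ snd y * complex_of_real (d $ m)"

text \<open>\<open>[(\<beta>, 1, d), \<cdot>] + (\<Sum>l=1..n. b(l) [(\<beta>, \<alpha>(l), e(l)), \<cdot>])\<close>\<close>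

definition bracket_sum :: "real \<Rightarrow> real^'m \<Rightarrow> nat \<Rightarrow> (nat \<Rightarrow> real) \<Rightarrow> (nat \<Rightarrow> complex) \<Rightarrow>
    (nat \<Rightarrow> real^'m) \<Rightarrow> 'm state \<Rightarrow> complex" where
  "bracket_sum \<beta> d n b \<alpha> e x =
     bracket (of_real \<beta>) 1 d x + (\<Sum>l=1..n. of_real (b l) * bracket (of_real \<beta>) (\<alpha> l) (e l) x)"

end

theory Submission
  imports Defs
begin

text \<open>Applying the transition operator to \<open>[(\<beta>, \<alpha>, d), \<cdot>]\<close> with \<open>A(\<beta>, \<alpha>) d = d\<close> reproduces the
  function up to an error \<open>\<beta> powi y(1) * c(\<beta>, \<alpha>, d)(m)\<close> on the line \<open>y(2) = 0\<close>.  The conjugate points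
  share the same \<open>\<beta>\<close>, so the span condition lets the errors cancel, and the resulting function \<open>h\<close> is
  harmonic.

  On \<open>B\<close> such an \<open>h\<close> is bounded and decays geometrically in the distance \<open>y(1) - y(2)\<close> to the exit
  boundary.  The distance is lowered by one with positive probability as soon as the modulating chain
  sits at a state with \<open>P(m, m) > 0\<close>, which exists by stability and is reachable by irreducibility;
  hence from distance at most \<open>D\<close> the walk exits within a bounded time with probability bounded below.
  Therefore the probability of being at distance at most \<open>D\<close> at time \<open>k\<close> without having exited tends
  to \<open>0\<close>, so \<open>E[h(Y\<^sub>k, M\<^sub>k); \<tau> \<ge> k]\<close> tends to \<open>0\<close> although \<open>\<tau> = \<infinity>\<close> may have positive
  probability, and optional stopping at \<open>min \<tau> k\<close> gives the representation.

  On the diagonal the terms with \<open>|\<alpha>| < 1\<close> vanish in the limit, so that only the linear combination of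
  \<open>d\<^sub>2, e\<^sub>2, \<dots>\<close> equal to the all-ones vector remains.\<close>

section \<open>First-step analysis of the path law\<close>

lemma space_path_law [simp]: "space (path_law K x) = UNIV"
proof -
  interpret IT: Ionescu_Tulcea "chain_kernel K x" "\<lambda>_. count_space UNIV"
    by (rule Ionescu_Tulcea_chain)
  show ?thesis by (simp add: path_law_def space_PiM)
qed

lemma sets_path_law [measurable_cong]: "sets (path_law K x) = sets (PiM UNIV (\<lambda>_. count_space UNIV))"
proof -
  interpret IT: Ionescu_Tulcea "chain_kernel K x" "\<lambda>_. count_space UNIV"
    by (rule Ionescu_Tulcea_chain)
  show ?thesis by (simp add: path_law_def)
qed

lemma prob_space_path_law: "prob_space (path_law K x)"
proof -
  interpret IT: Ionescu_Tulcea "chain_kernel K x" "\<lambda>_. count_space UNIV"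
    by (rule Ionescu_Tulcea_chain)
  show ?thesis
  proof (rule prob_spaceI)
    \<comment> \<open>The projective limit is known on cylinders over finite index sets, so the
      whole path space is rewritten as the cylinder over coordinate \<open>0\<close> without
      constraint.\<close>
    let ?S = "space (PiM {0..<1} (\<lambda>_. count_space UNIV)) :: (nat \<Rightarrow> 'a) set"
    have UNIV: "UNIV = prod_emb UNIV (\<lambda>_. count_space UNIV) {0..<1} ?S"
      by (auto simp: prod_emb_def space_PiM)
    have "emeasure (path_law K x) UNIV = emeasure (IT.CI {0..<1}) ?S"
      unfolding path_law_def by (subst UNIV, rule IT.lim) auto
    also have "\<dots> = 1"
      using prob_space.emeasure_space_1[OF IT.PF.prob_space_P, of "{0..<1}"] by (simp add: IT.PF.space_P)
    finally show "emeasure (path_law K x) (space (path_law K x)) = 1" by simp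
  qed
qed

text \<open>With countably many states, an event about coordinate \<open>i\<close> is a countable
  union of cylinders, one for each list of initial states. Length \<open>Suc n\<close> makes every
  generator fix coordinate \<open>1\<close>, the one on which \<open>path_law_split\<close>
  restricts; the empty set is added to make the family stable under intersection.\<close>

lemma sets_PiM_eq_sigma_cylinders:
  "sets (PiM UNIV (\<lambda>_. count_space (UNIV :: 's::countable set))) =
     sigma_sets UNIV (insert {} (range (\<lambda>(n, s). {\<omega> :: nat \<Rightarrow> 's. \<forall>i\<le>Suc n. \<omega> i = s i})))"
  (is "sets ?P = sigma_sets UNIV ?E")
proof (rule antisym)
  have "{\<omega> :: nat \<Rightarrow> 's. \<forall>i\<le>Suc n. \<omega> i = s i} \<in> sets ?P" for n s
  proof -
    have "{\<omega> \<in> space ?P. \<forall>i\<in>{..Suc n}. \<omega> i = s i} \<in> sets ?P"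
      by measurable
    then show ?thesis by (simp add: space_PiM Ball_def)
  qed
  then have "?E \<subseteq> sets ?P" by auto
  then show "sigma_sets UNIV ?E \<subseteq> sets ?P"
    using sets.sigma_sets_subset[of ?E ?P] by (simp add: space_PiM)
next
  have "{\<omega> :: nat \<Rightarrow> 's. \<omega> i \<in> A} \<in> sigma_sets UNIV ?E" for i A
  proof -
    have "{\<omega> :: nat \<Rightarrow> 's. \<omega> i \<in> A} =
       (\<Union>xs\<in>{xs. length xs = Suc (Suc i) \<and> xs ! i \<in> A}. {\<omega>. \<forall>j\<le>Suc i. \<omega> j = xs ! j})"
    proof (intro equalityI subsetI)
      fix \<omega> :: "nat \<Rightarrow> 's" assume "\<omega> \<in> {\<omega>. \<omega> i \<in> A}"
      then show "\<omega> \<in> (\<Union>xs\<in>{xs. length xs = Suc (Suc i) \<and> xs ! i \<in> A}. {\<omega>. \<forall>j\<le>Suc i. \<omega> j = xs ! j})"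
        by (intro UN_I[of "map \<omega> [0..<Suc (Suc i)]"]) (auto simp del: upt_Suc)
    qed auto
    also have "\<dots> \<in> sigma_sets UNIV ?E"
    proof (rule sigma_sets_UNION)
      show "countable ((\<lambda>xs. {\<omega>. \<forall>j\<le>Suc i. \<omega> j = xs ! j}) ` {xs :: 's list. length xs = Suc (Suc i) \<and> xs ! i \<in> A})"
        by simp
    qed (auto intro!: sigma_sets.Basic)
    finally show ?thesis .
  qed
  then show "sets ?P \<subseteq> sigma_sets UNIV ?E"
    by (simp add: sets_PiM_single) (intro sigma_sets_mono, auto)
qed

lemma measurable_case_nat_path [measurable]:
  "(\<lambda>\<omega>. case_nat x \<omega>) \<in> PiM UNIV (\<lambda>_. count_space UNIV) \<rightarrow>\<^sub>M PiM UNIV (\<lambda>_. count_space (UNIV :: 's set))"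
proof (rule measurable_PiM_single')
  fix i :: nat
  show "(\<lambda>\<omega>. case_nat x \<omega> i) \<in> PiM UNIV (\<lambda>_. count_space UNIV) \<rightarrow>\<^sub>M count_space (UNIV :: 's set)"
    by (cases i) auto
qed (auto simp: space_PiM)

text \<open>This is the Markov property at time 1. Cylinder masses are explicit products of
  transition probabilities, so both sides agree on an intersection-stable generator. Using densities
  instead of conditional laws covers states \<open>y\<close> of probability zero as well.\<close>

lemma path_law_split:
  fixes K :: "'s::countable \<Rightarrow> 's pmf"
  shows "density (path_law K x) (indicator {\<omega>. \<omega> (Suc 0) = y}) =
     density (distr (path_law K y) (PiM UNIV (\<lambda>_. count_space UNIV)) (case_nat x)) (\<lambda>_. ennreal (pmf (K x) y))"
  (is "?L = ?R")
proof (rule measure_eqI_generator_eq_countable)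
  let ?P = "PiM UNIV (\<lambda>_. count_space UNIV) :: (nat \<Rightarrow> 's) measure"
  let ?cyl = "\<lambda>(n, s). {\<omega> :: nat \<Rightarrow> 's. \<forall>i\<le>Suc n. \<omega> i = s i}"
  let ?E = "insert {} (range ?cyl)"
  have B: "{\<omega>. \<omega> (Suc 0) = y} \<in> sets ?P"
  proof -
    have "{\<omega> \<in> space ?P. \<omega> (Suc 0) = y} \<in> sets ?P" by measurable
    then show ?thesis by (simp add: space_PiM)
  qed
  show "Int_stable ?E"
  proof (rule Int_stableI)
    fix A B assume "A \<in> ?E" "B \<in> ?E"
    then consider "A \<inter> B = {}" | n s m t where "A = ?cyl (n, s)" "B = ?cyl (m, t)" "A \<inter> B \<noteq> {}"
      by blast
    then show "A \<inter> B \<in> ?E"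
    proof cases
      case 2
      then obtain \<omega> where "\<omega> \<in> A" "\<omega> \<in> B" by blast
      \<comment> \<open>Two cylinders with a common path \<omega> fix coordinates consistently, so
        the longer one, described by \<omega>, is the intersection.\<close>
      then have "A \<inter> B = ?cyl (max n m, \<omega>)"
        using 2(1,2) by (auto simp: le_max_iff_disj not_less_eq_eq) (metis max_def nat_le_linear)+
      then show ?thesis by blast
    qed auto
  qed
  show "?E \<subseteq> Pow UNIV" by simp
  show "sets ?L = sigma_sets UNIV ?E" "sets ?R = sigma_sets UNIV ?E"
    by (simp_all only: sets_density sets_distr sets_path_law sets_PiM_eq_sigma_cylinders)
  show "emeasure ?L X = emeasure ?R X" if "X \<in> ?E" for X
  proof (cases "X = {}")
    case False
    with that have "X \<in> range ?cyl" by (simp only: insert_iff simp_thms)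
    then obtain p where "X = ?cyl p" by (rule rangeE)
    then have X: "X = {\<omega>. \<forall>i\<le>Suc n. \<omega> i = s i}" if "p = (n, s)" for n s using that by simp
    obtain n s where "p = (n, s)" by (cases p)
    note X = X[OF this]
    have XP: "X \<in> sets ?P" using that unfolding sets_PiM_eq_sigma_cylinders by (rule sigma_sets.Basic)
    have "emeasure ?L X = emeasure (path_law K x) ({\<omega>. \<omega> (Suc 0) = y} \<inter> X)"
      using XP B by (intro emeasure_restricted) (simp_all add: sets_path_law)
    also have "\<dots> = (if s 0 = x \<and> s 1 = y then ennreal (pmf (K x) y) *
       (\<Prod>i<n. ennreal (pmf (K (s (Suc i))) (s (Suc (Suc i))))) else 0)"
    proof (cases "s 1 = y")
      case True
      then have "{\<omega>. \<omega> (Suc 0) = y} \<inter> X = {\<omega>. \<forall>i\<le>Suc n. \<omega> i = s i}" using X by auto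
      then show ?thesis using True unfolding emeasure_path_law_cylinder 
        by (simp add: prod.lessThan_Suc_shift emeasure_path_law_cylinder del: prod.lessThan_Suc)
    next
      case False
      then have "{\<omega>. \<omega> (Suc 0) = y} \<inter> X = {}" using X by auto
      then show ?thesis using False by simp
    qed
    also have "\<dots> = ennreal (pmf (K x) y) * emeasure (path_law K y) (case_nat x -` X)"
    proof -
      have "case_nat x -` X = {\<omega>. \<forall>i<Suc (Suc n). case_nat x \<omega> i = s i}"
        unfolding X by (simp add: vimage_def less_Suc_eq_le)
      also have "\<dots> = {\<omega>. x = s 0 \<and> (\<forall>i\<le>n. \<omega> i = s (Suc i))}"
        by (subst All_less_Suc2) (simp only: nat.case less_Suc_eq_le eq_commute)
      finally have X': "case_nat x -` X = {\<omega>. x = s 0 \<and> (\<forall>i\<le>n. \<omega> i = s (Suc i))}" .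
      show ?thesis
        unfolding X' by (cases "s 0 = x") (simp_all add: emeasure_path_law_cylinder)
    qed
    also have "\<dots> = emeasure ?R X"
      using XP by (simp add: emeasure_density_const emeasure_distr measurable_cong_sets[OF sets_path_law refl])
    finally show ?thesis .
  qed simp
  \<comment> \<open>Uniqueness of measures requires a countable cover by generators of finite mass:
    the cylinders fixing exactly coordinates \<open>0\<close> and \<open>1\<close>.\<close>
  let ?A = "range (\<lambda>p. ?cyl (0, case_nat (fst p) (\<lambda>_. snd p)))"
  show "?A \<subseteq> ?E" by blast
  show "\<Union>?A = UNIV"
  proof -
    have "\<omega> \<in> ?cyl (0, case_nat (\<omega> 0) (\<lambda>_. \<omega> (Suc 0)))" for \<omega> :: "nat \<Rightarrow> 's"
      by (auto simp: le_Suc_eq)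
    then have "\<omega> \<in> \<Union>?A" for \<omega>
      by (intro UnionI[OF rangeI[of _ "(\<omega> 0, \<omega> (Suc 0))"]]) simp
    then show ?thesis by blast
  qed
  show "countable ?A" by simp
  interpret prob_space "path_law K x" by (rule prob_space_path_law)
  show "emeasure ?L a \<noteq> \<infinity>" if "a \<in> ?A" for a
  proof -
    have a: "a \<in> sets ?P"
      using that unfolding sets_PiM_eq_sigma_cylinders by (intro sigma_sets.Basic) blast
    have "emeasure ?L a = emeasure (path_law K x) ({\<omega>. \<omega> (Suc 0) = y} \<inter> a)"
      using a B by (intro emeasure_restricted) (simp_all add: sets_path_law)
    then show ?thesis by simp
  qed
qed

text \<open>Finite support of \<open>K x\<close> turns the integral into a finite sum over the value
  of coordinate \<open>1\<close>, and \<open>path_law_split\<close> rewrites each summand.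
  Boundedness of \<open>F\<close> gives integrability of the pieces.\<close>

lemma integral_path_law_first_step:
  fixes K :: "'s::countable \<Rightarrow> 's pmf" and F :: "(nat \<Rightarrow> 's) \<Rightarrow> 'b::{banach, second_countable_topology}"
  assumes fin: "finite (set_pmf (K x))"
    and F [measurable]: "F \<in> borel_measurable (PiM UNIV (\<lambda>_. count_space UNIV))"
    and bound: "\<And>\<omega>. norm (F \<omega>) \<le> c"
  shows "(\<integral>\<omega>. F \<omega> \<partial>path_law K x) =
    measure_pmf.expectation (K x) (\<lambda>y. \<integral>\<omega>. F (case_nat x \<omega>) \<partial>path_law K y)"
proof -
  let ?P = "PiM UNIV (\<lambda>_. count_space UNIV) :: (nat \<Rightarrow> 's) measure"
  let ?S = "set_pmf (K x)"
  let ?B = "\<lambda>y. {\<omega> :: nat \<Rightarrow> 's. \<omega> (Suc 0) = y}"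
  interpret prob_space "path_law K x" by (rule prob_space_path_law)
  have BP: "?B y \<in> sets ?P" for y
  proof -
    have "{\<omega> \<in> space ?P. \<omega> (Suc 0) = y} \<in> sets ?P" by measurable
    then show ?thesis by (simp add: space_PiM)
  qed
  then have B [measurable]: "?B y \<in> sets (path_law K x)" for y by (simp add: sets_path_law)
  have distr_prob: "emeasure (distr (path_law K y) ?P (case_nat x)) UNIV = 1" for y
    using prob_space.emeasure_space_1[OF prob_space_path_law, of K y]
    by (subst emeasure_distr) (auto simp: measurable_cong_sets[OF sets_path_law refl], auto simp: sets_PiM_eq_sigma_cylinders intro: sigma_sets_top)
  \<comment> \<open>Comparing total masses in \<open>path_law_split\<close> yields the law of
    coordinate \<open>1\<close>.\<close>
  have PB: "emeasure (path_law K x) (?B y) = pmf (K x) y" for y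
  proof -
    have U: "UNIV \<in> sets ?P" using sets.top[of ?P] by (simp add: space_PiM)
    have "emeasure (path_law K x) (?B y) = emeasure (density (path_law K x) (indicator (?B y))) UNIV"
      using U B[of y] by (subst emeasure_density) (simp_all add: sets_path_law)
    also have "\<dots> = pmf (K x) y"
      unfolding path_law_split using U distr_prob[of y]
      by (subst emeasure_density) (auto simp: nn_integral_cmult_indicator space_PiM)
    finally show ?thesis .
  qed
  have AE_S: "AE \<omega> in path_law K x. \<omega> (Suc 0) \<in> ?S"
  proof -
    have "prob (\<Union>y\<in>?S. ?B y) = (\<Sum>y\<in>?S. prob (?B y))"
      using fin by (intro finite_measure_finite_Union) (auto simp: disjoint_family_on_def)
    also have "\<dots> = (\<Sum>y\<in>?S. pmf (K x) y)" using PB by (simp add: measure_def)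
    also have "\<dots> = 1" using fin by (simp add: sum_pmf_eq_1)
    finally show ?thesis by (rule AE_prob_1[THEN AE_mp]) auto
  qed
  have "(\<integral>\<omega>. F \<omega> \<partial>path_law K x) = (\<integral>\<omega>. (\<Sum>y\<in>?S. indicator (?B y) \<omega> *\<^sub>R F \<omega>) \<partial>path_law K x)"
  proof (intro integral_cong_AE)
    show "AE \<omega> in path_law K x. F \<omega> = (\<Sum>y\<in>?S. indicator (?B y) \<omega> *\<^sub>R F \<omega>)"
      using AE_S by eventually_elim (use fin in \<open>simp add: scaleR_left.sum[symmetric] indicator_def\<close>)
  qed measurable
  also have "\<dots> = (\<Sum>y\<in>?S. \<integral>\<omega>. indicator (?B y) \<omega> *\<^sub>R F \<omega> \<partial>path_law K x)"
    using bound by (intro Bochner_Integration.integral_sum integrable_const_bound[where B = c])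
      (auto simp: indicator_def intro: order_trans[OF norm_ge_zero bound])
  also have "\<dots> = (\<Sum>y\<in>?S. pmf (K x) y *\<^sub>R (\<integral>\<omega>. F (case_nat x \<omega>) \<partial>path_law K y))"
  proof (rule sum.cong[OF refl])
    fix y
    have "(\<integral>\<omega>. indicator (?B y) \<omega> *\<^sub>R F \<omega> \<partial>path_law K x) =
        (\<integral>\<omega>. F \<omega> \<partial>density (path_law K x) (\<lambda>\<omega>. ennreal (indicator (?B y) \<omega>)))"
      by (subst integral_density) auto
    also have "\<dots> = (\<integral>\<omega>. F \<omega> \<partial>density (distr (path_law K y) ?P (case_nat x)) (\<lambda>_. ennreal (pmf (K x) y)))"
      unfolding ennreal_indicator by (subst path_law_split[symmetric]) (rule refl)
    also have "\<dots> = (\<integral>\<omega>. pmf (K x) y *\<^sub>R F \<omega> \<partial>distr (path_law K y) ?P (case_nat x))"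
      by (subst integral_density) auto
    also have "\<dots> = pmf (K x) y *\<^sub>R (\<integral>\<omega>. F (case_nat x \<omega>) \<partial>path_law K y)"
      by (simp add: integral_distr measurable_cong_sets[OF sets_path_law refl])
    finally show "(\<integral>\<omega>. indicator (?B y) \<omega> *\<^sub>R F \<omega> \<partial>path_law K x) = \<dots>" .
  qed
  also have "\<dots> = measure_pmf.expectation (K x) (\<lambda>y. \<integral>\<omega>. F (case_nat x \<omega>) \<partial>path_law K y)"
    using fin by (subst integral_measure_pmf[of ?S]) auto
  finally show ?thesis .
qed

section \<open>Chains stopped at the exit boundary\<close>

lemma exit_time_eq:
  "exit_time \<omega> = (if \<exists>k. fst (\<omega> k) \<in> bd_B then enat (LEAST k. fst (\<omega> k) \<in> bd_B) else \<infinity>)"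
proof (cases "\<exists>k. fst (\<omega> k) \<in> bd_B")
  case True
  have "exit_time \<omega> = enat (LEAST k. fst (\<omega> k) \<in> bd_B)"
    unfolding exit_time_def
  proof (rule antisym)
    show "Inf {enat k |k. fst (\<omega> k) \<in> bd_B} \<le> enat (LEAST k. fst (\<omega> k) \<in> bd_B)"
      using LeastI_ex[OF True] by (intro Inf_lower) blast
    show "enat (LEAST k. fst (\<omega> k) \<in> bd_B) \<le> Inf {enat k |k. fst (\<omega> k) \<in> bd_B}"
      by (intro Inf_greatest) (auto intro: Least_le)
  qed
  with True show ?thesis by simp
next
  case False
  then have "{enat k |k. fst (\<omega> k) \<in> bd_B} = {}" by blast
  with False show ?thesis by (simp add: exit_time_def Inf_enat_def)
qed

lemma exit_value_eq:
  "exit_value f \<omega> = (if \<exists>k. fst (\<omega> k) \<in> bd_B then f (\<omega> (LEAST k. fst (\<omega> k) \<in> bd_B)) else 0)"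
  by (simp add: exit_value_def exit_time_eq)

text \<open>Truncating in time gives bounded approximations of \<open>exit_value\<close> that need
  no finiteness of the exit time. Recursion along the first coordinate fits first-step analysis and
  makes measurability an induction.\<close>

primrec early_exit :: "('m state \<Rightarrow> complex) \<Rightarrow> nat \<Rightarrow> (nat \<Rightarrow> 'm state) \<Rightarrow> complex" where
  "early_exit f 0 \<omega> = 0"
| "early_exit f (Suc k) \<omega> =
     (if fst (\<omega> 0) \<in> bd_B then f (\<omega> 0) else early_exit f k (\<lambda>n. \<omega> (Suc n)))"

lemma early_exit_eq:
  "early_exit f k \<omega> = (if \<exists>j<k. fst (\<omega> j) \<in> bd_B then exit_value f \<omega> else 0)"
proof (induction k arbitrary: \<omega>)
  case (Suc k)
  let ?P = "\<lambda>j. fst (\<omega> j) \<in> bd_B"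
  show ?case
  proof (cases "?P 0")
    case True
    then have "(LEAST j. ?P j) = 0" by (rule Least_eq_0)
    with True show ?thesis by (auto simp: exit_value_eq)
  next
    case False
    have "(LEAST j. ?P j) = Suc (LEAST j. ?P (Suc j))" if "\<exists>j. ?P (Suc j)"
      using that False by (auto intro: Least_Suc)
    moreover have "(\<exists>j. ?P j) \<longleftrightarrow> (\<exists>j. ?P (Suc j))"
      using False by (metis not0_implies_Suc)
    moreover have "(\<exists>j<Suc k. ?P j) \<longleftrightarrow> (\<exists>j<k. ?P (Suc j))"
      using False by (simp only: Ex_less_Suc2 simp_thms)
    ultimately show ?thesis
      using False by (auto simp: Suc.IH exit_value_eq)
  qed
qed simp

lemma early_exit_tendsto: "(\<lambda>k. early_exit f k \<omega>) \<longlonglongrightarrow> exit_value f \<omega>"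
proof (cases "\<exists>j. fst (\<omega> j) \<in> bd_B")
  case True
  then obtain j where "fst (\<omega> j) \<in> bd_B" ..
  then have "eventually (\<lambda>k. early_exit f k \<omega> = exit_value f \<omega>) sequentially"
    by (intro eventually_sequentiallyI[of "Suc j"]) (auto simp: early_exit_eq Suc_le_eq)
  then show ?thesis by (rule tendsto_eventually)
next
  case False
  then show ?thesis by (simp add: early_exit_eq exit_value_eq)
qed

lemma early_exit_bound:
  assumes "\<And>x. norm (f x) \<le> c"
  shows "norm (early_exit f k \<omega>) \<le> c"
proof -
  have "0 \<le> c" using order_trans[OF norm_ge_zero assms] .
  then show ?thesis by (induction k arbitrary: \<omega>) (simp_all add: assms)
qed

lemma measurable_shift_path [measurable]:
  "(\<lambda>\<omega> n. \<omega> (Suc n)) \<in> PiM UNIV (\<lambda>_. count_space UNIV) \<rightarrow>\<^sub>M PiM UNIV (\<lambda>_. count_space (UNIV :: 's set))"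
  by (rule measurable_PiM_single') (auto simp: space_PiM)

lemma measurable_early_exit [measurable]:
  "early_exit f k \<in> borel_measurable (PiM UNIV (\<lambda>_. count_space (UNIV :: 'm::countable state set)))"
proof (induction k)
  case (Suc k)
  let ?P = "PiM UNIV (\<lambda>_. count_space (UNIV :: 'm state set))"
  have comp: "(\<lambda>\<omega>. g (\<omega> 0)) \<in> ?P \<rightarrow>\<^sub>M N" if "range g \<subseteq> space N" for g :: "'m state \<Rightarrow> 'c" and N
    by (rule measurable_compose[OF measurable_component_singleton]) (use that in auto)
  have "early_exit f (Suc k) = (\<lambda>\<omega>. if fst (\<omega> 0) \<in> bd_B then f (\<omega> 0) else early_exit f k (\<lambda>n. \<omega> (Suc n)))"
    by (rule ext) (rule early_exit.simps)
  also have "\<dots> \<in> borel_measurable ?P"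
    by (intro measurable_If comp measurable_compose[OF measurable_shift_path Suc] predE) auto
  finally show ?case .
qed simp

lemma measurable_exit_value [measurable]:
  "exit_value f \<in> borel_measurable (PiM UNIV (\<lambda>_. count_space (UNIV :: 'm::countable state set)))"
  by (rule borel_measurable_LIMSEQ_metric[OF measurable_early_exit early_exit_tendsto])

lemma
  fixes K :: "'m::countable state \<Rightarrow> 'm state pmf"
  assumes f: "\<And>x. norm (f x) \<le> c"
  shows integrable_exit_value: "integrable (path_law K x) (exit_value f)"
    and integral_early_exit_tendsto:
      "(\<lambda>k. \<integral>\<omega>. early_exit f k \<omega> \<partial>path_law K x) \<longlonglongrightarrow> (\<integral>\<omega>. exit_value f \<omega> \<partial>path_law K x)"
proof -
  interpret prob_space "path_law K x" by (rule prob_space_path_law)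
  show "integrable (path_law K x) (exit_value f)"
    by (rule integrable_dominated_convergence[where w = "\<lambda>_. c" and s = "early_exit f"])
      (auto intro: early_exit_tendsto early_exit_bound f)
  show "(\<lambda>k. \<integral>\<omega>. early_exit f k \<omega> \<partial>path_law K x) \<longlonglongrightarrow> (\<integral>\<omega>. exit_value f \<omega> \<partial>path_law K x)"
    by (rule integral_dominated_convergence[where w = "\<lambda>_. c"])
      (auto intro: early_exit_tendsto early_exit_bound f)
qed

section \<open>The transition operator killed at the exit boundary, and survival
  probabilities\<close>

text \<open>The iterate \<open>(kill K ^^ k) w x\<close> is the expectation of \<open>w\<close> at
  time \<open>k\<close> on the event \<tau> \<ge> \<open>k\<close>. The value type is left open
  because it is used for complex harmonic functions and for their real norms.\<close>

definition kill :: "('m state \<Rightarrow> 'm state pmf) \<Rightarrow> ('m state \<Rightarrow> 'b::{banach, second_countable_topology}) \<Rightarrow> 'm state \<Rightarrow> 'b"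
  where "kill K w x = (if fst x \<in> bd_B then 0 else measure_pmf.expectation (K x) w)"

lemma kill_boundary [simp]: "fst x \<in> bd_B \<Longrightarrow> kill K w x = 0"
  and kill_interior [simp]: "fst x \<notin> bd_B \<Longrightarrow> kill K w x = measure_pmf.expectation (K x) w"
  by (simp_all add: kill_def)

text \<open>Finite support makes every function integrable for one step, even one unbounded outside
  \<open>region_B\<close>. By \<open>region_K\<close> the chain cannot leave \<open>region_B\<close>
  before the exit, so bounds there suffice.\<close>

locale exit_chain =
  fixes K :: "'m::countable state \<Rightarrow> 'm state pmf"
  assumes finite_K [simp]: "finite (set_pmf (K x))"
    and region_K: "fst x \<in> region_B \<Longrightarrow> fst x \<notin> bd_B \<Longrightarrow> y \<in> set_pmf (K x) \<Longrightarrow> fst y \<in> region_B"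
begin

lemma integrable_K [simp]: "integrable (measure_pmf (K x)) w"
  for w :: "'m state \<Rightarrow> 'b::{banach, second_countable_topology}"
  by (rule integrable_measure_pmf_finite) simp

lemma expectation_K_cong:
  fixes u v :: "'m state \<Rightarrow> 'b::{banach, second_countable_topology}"
  assumes "\<And>y. y \<in> set_pmf (K x) \<Longrightarrow> u y = v y"
  shows "measure_pmf.expectation (K x) u = measure_pmf.expectation (K x) v"
  by (rule integral_cong_AE) (auto simp: AE_measure_pmf_iff assms)

lemma integral_early_exit_Suc:
  assumes f: "\<And>x. norm (f x) \<le> c"
  shows "(\<integral>\<omega>. early_exit f (Suc k) \<omega> \<partial>path_law K x) =
    (if fst x \<in> bd_B then f x
     else measure_pmf.expectation (K x) (\<lambda>y. \<integral>\<omega>. early_exit f k \<omega> \<partial>path_law K y))"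
proof -
  have "measure (path_law K y) UNIV = 1" for y
    using prob_space.prob_space[OF prob_space_path_law, of K y] by simp
  then have const: "(\<integral>\<omega>. z \<partial>path_law K y) = z" for z :: complex and y
    by simp
  have const': "measure_pmf.expectation (K x) (\<lambda>y. z) = z" for z :: complex
    by simp
  have step: "early_exit f (Suc k) (case_nat x \<omega>) = (if fst x \<in> bd_B then f x else early_exit f k \<omega>)" for \<omega>
    by simp
  show ?thesis
    by (subst integral_path_law_first_step[OF finite_K measurable_early_exit early_exit_bound[OF f]])
      (simp add: step const const' del: early_exit.simps lebesgue_integral_const)
qed

text \<open>This is optional stopping at the minimum of \<tau> and \<open>k\<close>: the killed
  iterate on the right is the contribution of paths with \<tau> \<ge> \<open>k\<close>. The boundary
  data are cut to zero off \<open>bd_B\<close>, hence bounded everywhere although \<open>h\<close>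
  is controlled only on \<open>region_B\<close>.\<close>

lemma integral_early_exit:
  assumes h: "\<And>x. fst x \<in> region_B \<Longrightarrow> norm (h x) \<le> c" "0 \<le> c"
    and harmonic: "\<And>x. fst x \<in> region_B \<Longrightarrow> fst x \<notin> bd_B \<Longrightarrow> measure_pmf.expectation (K x) h = h x"
    and x: "fst x \<in> region_B"
  shows "(\<integral>\<omega>. early_exit (\<lambda>x. if fst x \<in> bd_B then h x else 0) k \<omega> \<partial>path_law K x) =
    h x - (kill K ^^ k) h x"
  using x
proof (induction k arbitrary: x)
  case (Suc k)
  let ?f = "\<lambda>x. if fst x \<in> bd_B then h x else 0"
  have "norm (?f x) \<le> c" for x
    using h by (auto simp: bd_B_def region_B_def)
  note step = integral_early_exit_Suc[OF this]
  show ?case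
  proof (cases "fst x \<in> bd_B")
    case True
    then show ?thesis by (simp add: step del: early_exit.simps)
  next
    case False
    have "measure_pmf.expectation (K x) (\<lambda>y. \<integral>\<omega>. early_exit ?f k \<omega> \<partial>path_law K y) =
        measure_pmf.expectation (K x) (\<lambda>y. h y - (kill K ^^ k) h y)"
      by (intro expectation_K_cong Suc.IH region_K[OF Suc.prems False])
    also have "\<dots> = h x - (kill K ^^ Suc k) h x"
      using False harmonic[OF Suc.prems False] by simp
    finally show ?thesis using False by (simp add: step del: early_exit.simps)
  qed
next
  case 0
  have "early_exit f 0 = (\<lambda>_. 0)" for f :: "'m state \<Rightarrow> complex"
    by (rule ext) simp
  then show ?case by (simp only:) simp
qed

lemma kill_pow_mono:
  fixes u v :: "'m state \<Rightarrow> real"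
  assumes "\<And>x. fst x \<in> region_B \<Longrightarrow> u x \<le> v x" "fst x \<in> region_B"
  shows "(kill K ^^ k) u x \<le> (kill K ^^ k) v x"
  using assms(2)
proof (induction k arbitrary: x)
  case (Suc k)
  show ?case
  proof (cases "fst x \<in> bd_B")
    case False
    have "measure_pmf.expectation (K x) ((kill K ^^ k) u) \<le> measure_pmf.expectation (K x) ((kill K ^^ k) v)"
      by (intro integral_mono_AE) (auto simp: AE_measure_pmf_iff intro!: Suc.IH region_K[OF Suc.prems False])
    then show ?thesis using False by simp
  qed simp
qed (use assms in auto)

lemma kill_pow_linear:
  fixes u v :: "'m state \<Rightarrow> real"
  shows "(kill K ^^ k) (\<lambda>x. a * u x + b * v x) = (\<lambda>x. a * (kill K ^^ k) u x + b * (kill K ^^ k) v x)"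
proof (induction k)
  case (Suc k)
  have "kill K (\<lambda>x. a * (kill K ^^ k) u x + b * (kill K ^^ k) v x) x =
      a * kill K ((kill K ^^ k) u) x + b * kill K ((kill K ^^ k) v) x" for x
    by (cases "fst x \<in> bd_B") simp_all
  then show ?case by (simp only: funpow.simps o_apply Suc.IH ext)
qed simp

lemma norm_kill_pow:
  fixes w :: "'m state \<Rightarrow> 'b::{banach, second_countable_topology}"
  shows "norm ((kill K ^^ k) w x) \<le> (kill K ^^ k) (\<lambda>x. norm (w x)) x"
proof (induction k arbitrary: x)
  case (Suc k)
  have "norm (measure_pmf.expectation (K x) ((kill K ^^ k) w)) \<le>
      measure_pmf.expectation (K x) (\<lambda>y. norm ((kill K ^^ k) w y))"
    by (rule integral_norm_bound)
  also have "\<dots> \<le> measure_pmf.expectation (K x) ((kill K ^^ k) (\<lambda>x. norm (w x)))"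
    by (intro integral_mono) (auto simp: Suc.IH)
  finally show ?case by (cases "fst x \<in> bd_B") simp_all
qed simp

text \<open>The probability that \<tau> \<ge> \<open>k\<close> for the chain started at the given
  state.\<close>

abbreviation surv :: "nat \<Rightarrow> 'm state \<Rightarrow> real" where
  "surv k \<equiv> (kill K ^^ k) (\<lambda>_. 1)"

lemma kill_pow_nonneg:
  fixes u :: "'m state \<Rightarrow> real"
  assumes "\<And>x. 0 \<le> u x"
  shows "0 \<le> (kill K ^^ k) u x"
proof (induction k arbitrary: x)
  case (Suc k)
  then show ?case by (cases "fst x \<in> bd_B") (simp_all add: integral_nonneg)
qed (simp add: assms)

lemma surv_antimono: "surv (Suc k) x \<le> surv k x"
proof (induction k arbitrary: x)
  case 0
  then show ?case by (simp add: kill_def)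
next
  case (Suc k)
  have "measure_pmf.expectation (K x) (surv (Suc k)) \<le> measure_pmf.expectation (K x) (surv k)"
    by (intro integral_mono Suc.IH integrable_K)
  then show ?case by (cases "fst x \<in> bd_B") simp_all
qed

lemma surv_mono: "k \<le> n \<Longrightarrow> surv n x \<le> surv k x"
  by (rule lift_Suc_antimono_le[of "\<lambda>k. surv k x"]) (rule surv_antimono)

lemma surv_le_1: "surv k x \<le> 1"
  using surv_mono[of 0 k x] by simp

text \<open>The chance of exiting between times \<open>k\<close> and \<open>k + N\<close> vanishes, and it is at least \<open>\<delta>\<close> times
  the chance of being in \<open>C\<close> at time \<open>k\<close> before the exit.\<close>

lemma kill_pow_indicator_tendsto_0:
  assumes C: "\<And>x. x \<in> C \<Longrightarrow> surv N x \<le> 1 - \<delta>" and \<delta>: "0 < \<delta>"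
    and x: "fst x \<in> region_B"
  shows "(\<lambda>k. (kill K ^^ k) (indicat_real C) x) \<longlonglongrightarrow> 0"
proof -
  have "decseq (\<lambda>k. surv k x)" by (rule decseq_SucI) (rule surv_antimono)
  then have "Bseq (\<lambda>k. surv k x) \<and> monoseq (\<lambda>k. surv k x)"
    using surv_le_1[of _ x] kill_pow_nonneg[of "\<lambda>_. 1" _ x]
    by (auto intro!: BseqI'[of _ 1] simp: decseq_imp_monoseq)
  then obtain l where l: "(\<lambda>k. surv k x) \<longlonglongrightarrow> l"
    using Bseq_monoseq_convergent convergentD by blast
  have "(\<lambda>k. (surv k x - surv (k + N) x) / \<delta>) \<longlonglongrightarrow> (l - l) / \<delta>"
    by (intro tendsto_intros l LIMSEQ_ignore_initial_segment) (use \<delta> in simp)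
  moreover have "\<delta> * (kill K ^^ k) (indicat_real C) x \<le> surv k x - surv (k + N) x" for k
  proof -
    have "\<delta> * (kill K ^^ k) (indicat_real C) x = (kill K ^^ k) (\<lambda>x. \<delta> * indicat_real C x + 0 * 0) x"
      by (subst kill_pow_linear) simp
    \<comment> \<open>On \<open>C\<close> the survival bound gives \<delta> \<le>
      \<open>1 - surv N\<close>, and elsewhere the right side is nonnegative. Applying
      \<open>kill K ^^ k\<close> turns \<open>surv N\<close> into \<open>surv (k + N)\<close>; the
      products \<open>0 * 0\<close> and \<open>1 * 1\<close> only match the shape of
      \<open>kill_pow_linear\<close>.\<close>
    also have "\<dots> \<le> (kill K ^^ k) (\<lambda>x. 1 * 1 + (-1) * surv N x) x"
      by (intro kill_pow_mono x) (use C surv_le_1 in \<open>simp add: indicator_def, smt (verit)\<close>)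
    also have "\<dots> = surv k x - surv (k + N) x"
      by (subst kill_pow_linear) (simp add: funpow_add)
    finally show ?thesis .
  qed
  then have "(kill K ^^ k) (indicat_real C) x \<le> (surv k x - surv (k + N) x) / \<delta>" for k
    using \<delta> by (simp add: pos_le_divide_eq mult.commute)
  moreover have "0 \<le> (kill K ^^ k) (indicat_real C) x" for k
    by (rule kill_pow_nonneg) simp
  ultimately show ?thesis
    using tendsto_sandwich[of "\<lambda>_. 0" "\<lambda>k. (kill K ^^ k) (indicat_real C) x" sequentially
        "\<lambda>k. (surv k x - surv (k + N) x) / \<delta>" 0]
    by (simp only: eventually_True simp_thms tendsto_const diff_self div_0)
qed

text \<open>Letting \<open>k\<close> tend to infinity in \<open>integral_early_exit\<close>, it
  remains to show that the killed iterates of \<open>h\<close> vanish. Hypothesis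
  \<open>small\<close> replaces almost sure exit: wherever \<open>h\<close> is not small, an exit
  within \<open>N\<close> steps has probability at least \<delta>, and such places are rarely
  occupied by surviving paths at late times.\<close>

theorem exit_representation:
  assumes h: "\<And>x. fst x \<in> region_B \<Longrightarrow> norm (h x) \<le> c" "0 \<le> c"
    and harmonic: "\<And>x. fst x \<in> region_B \<Longrightarrow> fst x \<notin> bd_B \<Longrightarrow> measure_pmf.expectation (K x) h = h x"
    and small: "\<And>\<epsilon>. 0 < \<epsilon> \<Longrightarrow> \<exists>N. \<exists>\<delta>>0. \<forall>x. fst x \<in> region_B \<longrightarrow> norm (h x) \<le> \<epsilon> \<or> surv N x \<le> 1 - \<delta>"
    and x: "fst x \<in> region_B"
  defines "f \<equiv> \<lambda>x. if fst x \<in> bd_B then h x else 0"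
  shows "integrable (path_law K x) (exit_value f) \<and> h x = (\<integral>\<omega>. exit_value f \<omega> \<partial>path_law K x)"
proof -
  have f: "norm (f x) \<le> c" for x
    using h by (auto simp: f_def bd_B_def region_B_def)
  have "(\<lambda>k. (kill K ^^ k) h x) \<longlonglongrightarrow> 0"
  proof (rule LIMSEQ_I)
    fix \<epsilon> :: real assume "0 < \<epsilon>"
    then obtain N \<delta> where \<delta>: "0 < \<delta>"
      and N: "\<And>x. fst x \<in> region_B \<Longrightarrow> norm (h x) \<le> \<epsilon> / 2 \<or> surv N x \<le> 1 - \<delta>"
      using small[of "\<epsilon> / 2"] by (metis half_gt_zero)
    \<comment> \<open>On this set \<open>h\<close> is bounded by \<open>c\<close>; on the rest of
      \<open>region_B\<close> it is at most half of \<epsilon>.\<close>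
    let ?C = "{x. surv N x \<le> 1 - \<delta>}"
    have "(\<lambda>k. c * (kill K ^^ k) (indicat_real ?C) x) \<longlonglongrightarrow> c * 0"
      by (intro tendsto_mult tendsto_const kill_pow_indicator_tendsto_0[OF _ \<delta> x]) simp
    then have "eventually (\<lambda>k. c * (kill K ^^ k) (indicat_real ?C) x < \<epsilon> / 2) sequentially"
      by (rule order_tendstoD) (use \<open>0 < \<epsilon>\<close> in simp)
    moreover have "norm ((kill K ^^ k) h x) \<le> c * (kill K ^^ k) (indicat_real ?C) x + \<epsilon> / 2" for k
    proof -
      have "norm ((kill K ^^ k) h x) \<le> (kill K ^^ k) (\<lambda>x. norm (h x)) x"
        by (rule norm_kill_pow)
      also have "\<dots> \<le> (kill K ^^ k) (\<lambda>x. c * indicat_real ?C x + \<epsilon> / 2 * 1) x"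
      proof (rule kill_pow_mono[OF _ x])
        fix z :: "'m state" assume z: "fst z \<in> region_B"
        show "norm (h z) \<le> c * indicat_real ?C z + \<epsilon> / 2 * 1"
          using N[OF z] h(1)[OF z] h(2) \<open>0 < \<epsilon>\<close> by (cases "surv N z \<le> 1 - \<delta>") simp_all
      qed
      also have "\<dots> = c * (kill K ^^ k) (indicat_real ?C) x + \<epsilon> / 2 * surv k x"
        by (subst kill_pow_linear) simp
      also have "\<epsilon> / 2 * surv k x \<le> \<epsilon> / 2"
        using surv_le_1[of k x] \<open>0 < \<epsilon>\<close> by simp
      finally show ?thesis by simp
    qed
    ultimately have "eventually (\<lambda>k. norm ((kill K ^^ k) h x - 0) < \<epsilon>) sequentially"
      by (elim eventually_mono) (smt (verit) diff_zero field_sum_of_halves)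
    then show "\<exists>n0. \<forall>n\<ge>n0. norm ((kill K ^^ n) h x - 0) < \<epsilon>"
      by (simp add: eventually_sequentially)
  qed
  then have "(\<lambda>k. h x - (kill K ^^ k) h x) \<longlonglongrightarrow> h x - 0"
    by (intro tendsto_intros)
  moreover have "(\<lambda>k. h x - (kill K ^^ k) h x) \<longlonglongrightarrow> (\<integral>\<omega>. exit_value f \<omega> \<partial>path_law K x)"
    using integral_early_exit_tendsto[of f c K x, OF f] integral_early_exit[OF h harmonic x]
    unfolding f_def by simp
  ultimately show ?thesis
    using integrable_exit_value[OF f] LIMSEQ_unique by fastforce
qed

end

context exit_chain
begin

text \<open>One way to exit before time \<open>Suc N\<close> is to step to \<open>z\<close> and exit
  from there before time \<open>N\<close>. On the boundary the left side is zero and the right side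
  nonnegative.\<close>

lemma surv_Suc_le: "surv (Suc N) x \<le> 1 - pmf (K x) z * (1 - surv N z)"
proof (cases "fst x \<in> bd_B")
  case True
  have "pmf (K x) z * (1 - surv N z) \<le> 1 * 1"
    using surv_le_1[of N z] kill_pow_nonneg[of "\<lambda>_. 1" N z]
    by (intro mult_mono pmf_le_1) simp_all
  then show ?thesis using True by simp
next
  case False
  have "pmf (K x) z * (1 - surv N z) =
      measure_pmf.expectation (K x) (\<lambda>w. indicat_real {z} w * (1 - surv N z))"
    by (simp add: measure_pmf_single)
  also have "\<dots> \<le> measure_pmf.expectation (K x) (\<lambda>w. 1 - surv N w)"
    by (intro integral_mono integrable_K) (use surv_le_1 in \<open>auto simp: indicator_def\<close>)
  also have "\<dots> = 1 - measure_pmf.expectation (K x) (surv N)"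
    by simp
  finally show ?thesis using False by simp
qed

end

section \<open>Exit of the modulated walk\<close>

locale modulated_walk =
  fixes P :: "real^'m::finite^'m" and lam \<mu>\<^sub>1 \<mu>\<^sub>2 :: "'m \<Rightarrow> real"
  assumes stochastic: "stochastic P"
    and rates: "\<And>m. 0 < lam m" "\<And>m. 0 < \<mu>\<^sub>1 m" "\<And>m. 0 < \<mu>\<^sub>2 m" "\<And>m. lam m + \<mu>\<^sub>1 m + \<mu>\<^sub>2 m = 1"
begin

section \<open>One-step transitions of the modulated walk\<close>

abbreviation step :: "'m state \<Rightarrow> 'm state pmf" where
  "step \<equiv> YM_step P lam \<mu>\<^sub>1 \<mu>\<^sub>2"

lemma P_nonneg: "0 \<le> P $ i $ j" and P_row_sum: "(\<Sum>j\<in>UNIV. P $ i $ j) = 1"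
  using stochastic by (auto simp: stochastic_def)

lemma pmf_row: "pmf (embed_pmf (\<lambda>m'. P $ m $ m')) m' = P $ m $ m'"
  by (rule pmf_embed_pmf) (simp_all add: P_nonneg nn_integral_count_space_finite P_row_sum flip: ennreal_1)

lemma incr_wf: "pmf_of_list_wf [((-1, 0), lam m), ((1, 1), \<mu>\<^sub>1 m), ((0, -1), \<mu>\<^sub>2 m)]"
  using rates[of m] by (intro pmf_of_list_wfI) auto

lemma set_incr: "set_pmf (incr_pmf lam \<mu>\<^sub>1 \<mu>\<^sub>2 m) \<subseteq> {(-1, 0), (1, 1), (0, -1)}"
  using set_pmf_of_list[OF incr_wf] by (simp add: incr_pmf_def)

lemma finite_incr [simp]: "finite (set_pmf (incr_pmf lam \<mu>\<^sub>1 \<mu>\<^sub>2 m))"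
  using finite_subset[OF set_incr] by blast

lemma expectation_incr:
  fixes g :: "int \<times> int \<Rightarrow> 'b::{banach, second_countable_topology}"
  shows "measure_pmf.expectation (incr_pmf lam \<mu>\<^sub>1 \<mu>\<^sub>2 m) g =
    lam m *\<^sub>R g (-1, 0) + \<mu>\<^sub>1 m *\<^sub>R g (1, 1) + \<mu>\<^sub>2 m *\<^sub>R g (0, -1)"
proof -
  have "measure_pmf.expectation (incr_pmf lam \<mu>\<^sub>1 \<mu>\<^sub>2 m) g =
      (\<Sum>v\<in>{(-1, 0), (1, 1), (0, -1)}. pmf (incr_pmf lam \<mu>\<^sub>1 \<mu>\<^sub>2 m) v *\<^sub>R g v)"
    using set_incr by (intro integral_measure_pmf) auto
  then show ?thesis
    unfolding incr_pmf_def by (simp add: pmf_pmf_of_list[OF incr_wf])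
qed

lemma finite_step [simp]: "finite (set_pmf (step x))"
proof -
  obtain y m where "x = (y, m)" by (cases x)
  then show ?thesis by auto
qed

lemma expectation_step:
  fixes h :: "'m state \<Rightarrow> 'b::{banach, second_countable_topology}"
  shows "measure_pmf.expectation (step (y, m)) h =
    (\<Sum>m'\<in>UNIV - {m}. P $ m $ m' *\<^sub>R h (y, m')) +
    P $ m $ m *\<^sub>R (lam m *\<^sub>R h (move y (-1, 0), m) + \<mu>\<^sub>1 m *\<^sub>R h (move y (1, 1), m) + \<mu>\<^sub>2 m *\<^sub>R h (move y (0, -1), m))"
proof -
  have "measure_pmf.expectation (step (y, m)) h = (\<Sum>m'\<in>UNIV. P $ m $ m' *\<^sub>R
      measure_pmf.expectation (if m' \<noteq> m then return_pmf (y, m')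
             else map_pmf (\<lambda>v. (move y v, m)) (incr_pmf lam \<mu>\<^sub>1 \<mu>\<^sub>2 m)) h)"
    unfolding YM_step.simps by (subst pmf_expectation_bind[of UNIV]) (auto simp: pmf_row)
  also have "\<dots> = (\<Sum>m'\<in>UNIV - {m}. P $ m $ m' *\<^sub>R h (y, m')) + P $ m $ m *\<^sub>R
      measure_pmf.expectation (incr_pmf lam \<mu>\<^sub>1 \<mu>\<^sub>2 m) (\<lambda>v. h (move y v, m))"
    by (subst sum.remove[of _ m]) auto
  finally show ?thesis by (simp add: expectation_incr)
qed

lemma set_step: "z \<in> set_pmf (step (y, m)) \<Longrightarrow> fst z \<in> {y, move y (-1, 0), move y (1, 1), move y (0, -1)}"
  using set_incr by (fastforce split: if_splits)

text \<open>The increments change \<open>y(1) - y(2)\<close> by -1, 0 or 1, and a blocked move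
  changes nothing, so the walk cannot jump over the diagonal.\<close>

sublocale exit_chain step
proof
  show "fst z \<in> region_B" if "fst x \<in> region_B" "fst x \<notin> bd_B" "z \<in> set_pmf (step x)" for x z
  proof -
    obtain y m where "x = (y, m)" by (cases x)
    with that set_step[of z y m] show ?thesis
      by (auto simp: region_B_def bd_B_def move_def)
  qed
qed simp

lemma pmf_step_switch: "m' \<noteq> m \<Longrightarrow> P $ m $ m' \<le> pmf (step (y, m)) (y, m')"
proof -
  assume "m' \<noteq> m"
  have "P $ m $ m' = (\<Sum>m''\<in>{m'}. P $ m $ m'' *\<^sub>R indicat_real {(y, m')} (y, m''))"
    by simp
  also have "\<dots> \<le> (\<Sum>m''\<in>UNIV - {m}. P $ m $ m'' *\<^sub>R indicat_real {(y, m')} (y, m''))"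
    using \<open>m' \<noteq> m\<close> by (intro sum_mono2) (auto simp: P_nonneg)
  also have "\<dots> \<le> measure_pmf.expectation (step (y, m)) (indicat_real {(y, m')})"
    unfolding expectation_step using rates[of m] less_imp_le
    by (simp add: P_nonneg)
  finally show ?thesis by (simp add: measure_pmf_single)
qed

lemma pmf_step_left: "P $ m $ m * lam m \<le> pmf (step (y, m)) ((fst y - 1, snd y), m)"
proof -
  let ?z = "((fst y - 1, snd y), m)"
  have "P $ m $ m * lam m \<le> P $ m $ m *\<^sub>R (lam m *\<^sub>R indicat_real {?z} (move y (-1, 0), m) +
      \<mu>\<^sub>1 m *\<^sub>R indicat_real {?z} (move y (1, 1), m) + \<mu>\<^sub>2 m *\<^sub>R indicat_real {?z} (move y (0, -1), m))"
    using rates[of m] by (simp add: move_def mult_left_mono P_nonneg)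
  also have "\<dots> \<le> measure_pmf.expectation (step (y, m)) (indicat_real {?z})"
    unfolding expectation_step by (simp add: sum_nonneg P_nonneg)
  finally show ?thesis by (simp add: measure_pmf_single)
qed

section \<open>Uniform exit probabilities at bounded distance from the boundary\<close>

text \<open>One pair \<open>N\<close>, \<delta> has to serve the infinitely many positions at
  distance \<open>d\<close>. This is possible because the transitions used below have lower bounds
  that depend only on the modulating state.\<close>

definition exits_from :: "nat \<Rightarrow> 'm \<Rightarrow> bool" where
  "exits_from d m \<longleftrightarrow> (\<exists>N. \<exists>\<delta>>0. \<forall>y. fst y - int (snd y) = int d \<longrightarrow> surv N (y, m) \<le> 1 - \<delta>)"

lemma exits_from_0: "exits_from 0 m"
  \<comment> \<open>On the boundary \<open>surv 0\<close> is still 1, while \<open>surv 1\<close> is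
    0; hence \<open>N = 1\<close> and \<delta> = 1.\<close>
  unfolding exits_from_def by (intro exI[of _ 1] exI[of _ "1 :: real"]) (auto simp: bd_B_def)

text \<open>A transition of probability at least \<open>p\<close> costs one more unit of time and a
  factor \<open>p\<close> in \<delta>.\<close>

lemma exits_from_step:
  assumes "exits_from d' m'" "0 < p"
    and "\<And>y. fst y - int (snd y) = int d \<Longrightarrow>
      \<exists>y'. fst y' - int (snd y') = int d' \<and> p \<le> pmf (step (y, m)) (y', m')"
  shows "exits_from d m"
proof -
  obtain N \<delta> where \<delta>: "0 < \<delta>"
    and N: "\<And>y. fst y - int (snd y) = int d' \<Longrightarrow> surv N (y, m') \<le> 1 - \<delta>"
    using assms(1) unfolding exits_from_def by blast
  have "surv (Suc N) (y, m) \<le> 1 - p * \<delta>" if y: "fst y - int (snd y) = int d" for y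
  proof -
    obtain y' where y': "fst y' - int (snd y') = int d'" "p \<le> pmf (step (y, m)) (y', m')"
      using assms(3)[OF y] by blast
    have "p * \<delta> \<le> pmf (step (y, m)) (y', m') * (1 - surv N (y', m'))"
      using y' N[OF y'(1)] \<delta> by (intro mult_mono) auto
    then show ?thesis using surv_Suc_le[of N "(y, m)" "(y', m')"] by linarith
  qed
  then show ?thesis
    unfolding exits_from_def using \<delta> \<open>0 < p\<close>
    by (intro exI[of _ "Suc N"] exI[of _ "p * \<delta>"]) simp
qed

text \<open>A positive entry of a power of \<open>P\<close> gives a path of the modulating state
  from \<open>m\<close> to \<open>m'\<close>; switches along it leave the position, hence the
  distance, unchanged.\<close>

lemma exits_from_matrix_pow:
  assumes "exits_from d m'" "0 < matrix_pow P n $ m $ m'"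
  shows "exits_from d m"
  using assms(2)
proof (induction n arbitrary: m)
  case 0
  then show ?case using assms(1) by (auto simp: matrix_pow_def mat_def split: if_splits)
next
  case (Suc n)
  have "0 < (\<Sum>k\<in>UNIV. P $ m $ k * matrix_pow P n $ k $ m')"
    using Suc.prems by (simp add: matrix_pow_def matrix_matrix_mult_def)
  then obtain k where "0 < P $ m $ k * matrix_pow P n $ k $ m'"
    by (meson not_le sum_nonpos)
  then have k: "0 < P $ m $ k" "0 < matrix_pow P n $ k $ m'"
    using P_nonneg[of m k] by (auto simp: zero_less_mult_iff)
  show ?case
  proof (cases "k = m")
    \<comment> \<open>A loop of the modulating state would trigger an attempted increment of the
      walk. It is dropped from the path, as the remaining path already starts at
      \<open>m\<close>.\<close>
    case True
    then show ?thesis using Suc.IH k(2) by simp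
  next
    case False
    show ?thesis
      by (rule exits_from_step[OF Suc.IH[OF k(2)] k(1)]) (use pmf_step_switch[OF False] in blast)
  qed
qed

text \<open>Induction on the distance: the modulating state is first led to \<open>m0\<close>, where
  the increment (-1, 0) lowers the distance by one.\<close>

lemma exits_from_all:
  assumes irr: "irreducible_matrix P" and loop: "0 < P $ m0 $ m0"
  shows "exits_from d m"
proof (induction d arbitrary: m)
  case 0
  then show ?case by (rule exits_from_0)
next
  case (Suc d)
  have "exits_from (Suc d) m0"
  proof (rule exits_from_step[OF Suc.IH[of m0]])
    show "0 < P $ m0 $ m0 * lam m0" using loop rates(1) by simp
    fix y :: "int \<times> nat" assume "fst y - int (snd y) = int (Suc d)"
    then show "\<exists>y'. fst y' - int (snd y') = int d \<and> P $ m0 $ m0 * lam m0 \<le> pmf (step (y, m0)) (y', m0)"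
      by (intro exI[of _ "(fst y - 1, snd y)"] conjI pmf_step_left) simp
  qed
  with irr show ?case
    unfolding irreducible_matrix_def using exits_from_matrix_pow by blast
qed

text \<open>Only finitely many pairs of a distance up to \<open>D\<close> and a modulating state
  occur. Since \<open>surv\<close> decreases in time, the maximum of the times and the minimum of
  the constants serve all of them.\<close>

lemma surv_uniform:
  assumes "irreducible_matrix P" "0 < P $ m0 $ m0"
  shows "\<exists>N. \<exists>\<delta>>0. \<forall>y m. y \<in> region_B \<longrightarrow> fst y - int (snd y) \<le> int D \<longrightarrow> surv N (y, m) \<le> 1 - \<delta>"
proof -
  have "\<exists>N. \<exists>\<delta>>0. \<forall>(d, m)\<in>A. \<forall>y. fst y - int (snd y) = int d \<longrightarrow> surv N (y, m) \<le> 1 - \<delta>"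
    if "finite A" for A
    using that
  proof (induction A)
    case empty
    then show ?case by (auto intro: exI[of _ 1])
  next
    case (insert p A)
    obtain d m where p: "p = (d, m)" by (cases p)
    from exits_from_all[OF assms, of d m] obtain N1 \<delta>1 where 1: "0 < \<delta>1"
      "\<And>y. fst y - int (snd y) = int d \<Longrightarrow> surv N1 (y, m) \<le> 1 - \<delta>1"
      unfolding exits_from_def by blast
    from insert.IH obtain N2 \<delta>2 where 2: "0 < \<delta>2"
      "\<And>d m y. (d, m) \<in> A \<Longrightarrow> fst y - int (snd y) = int d \<Longrightarrow> surv N2 (y, m) \<le> 1 - \<delta>2"
      by blast
    have "surv (max N1 N2) (y, m') \<le> 1 - min \<delta>1 \<delta>2"
      if "(d', m') \<in> insert p A" "fst y - int (snd y) = int d'" for d' m' y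
      using that 1(2)[of y] 2(2)[of d' m' y] p
        surv_mono[of N1 "max N1 N2" "(y, m')"] surv_mono[of N2 "max N1 N2" "(y, m')"]
      by fastforce
    then have "\<forall>(d, m)\<in>insert p A. \<forall>y. fst y - int (snd y) = int d \<longrightarrow>
        surv (max N1 N2) (y, m) \<le> 1 - min \<delta>1 \<delta>2"
      by blast
    then show ?case using 1(1) 2(1)
      by (intro exI[of _ "max N1 N2"] exI[of _ "min \<delta>1 \<delta>2"]) simp
  qed
  from this[of "{..D} \<times> UNIV"] obtain N \<delta> where "0 < \<delta>"
    and N: "\<And>d m y. d \<le> D \<Longrightarrow> fst y - int (snd y) = int d \<Longrightarrow> surv N (y, m) \<le> 1 - \<delta>"
    by fastforce
  have "surv N (y, m) \<le> 1 - \<delta>" if "y \<in> region_B" "fst y - int (snd y) \<le> int D" for y m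
    using that by (intro N[of "nat (fst y - int (snd y))"]) (auto simp: region_B_def)
  with \<open>0 < \<delta>\<close> show ?thesis by blast
qed

text \<open>Given \<epsilon>, choose \<open>D\<close> with
  \<open>c * \<beta> ^ D < \<epsilon>\<close>: beyond distance \<open>D\<close> the function is
  small, and up to distance \<open>D\<close> the bound \<open>surv_uniform\<close> applies. This is
  the dichotomy that \<open>exit_representation\<close> asks for.\<close>

theorem bd_B_determinedI:
  assumes P: "irreducible_matrix P" "0 < P $ m0 $ m0"
    and harmonic: "YM_harmonic P lam \<mu>\<^sub>1 \<mu>\<^sub>2 h"
    and \<beta>: "0 < \<beta>" "\<beta> < 1"
    and decay: "\<And>y m. y \<in> region_B \<Longrightarrow> norm (h (y, m)) \<le> c * \<beta> ^ nat (fst y - int (snd y))"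
  shows "bd_B_determined P lam \<mu>\<^sub>1 \<mu>\<^sub>2 h"
proof -
  have c: "0 \<le> c"
    \<comment> \<open>At the origin, which lies on the diagonal, the decay factor is 1.\<close>
    using order_trans[OF norm_ge_zero decay[of "(0, 0)"]] by (simp add: region_B_def)
  have bound: "norm (h x) \<le> c" if "fst x \<in> region_B" for x
  proof -
    obtain y m where x: "x = (y, m)" by (cases x)
    have "c * \<beta> ^ nat (fst y - int (snd y)) \<le> c * 1"
      using c \<beta> by (intro mult_left_mono power_le_one) auto
    then show ?thesis using decay[of y m] that x by simp
  qed
  have small: "\<exists>N. \<exists>\<delta>>0. \<forall>x. fst x \<in> region_B \<longrightarrow> norm (h x) \<le> \<epsilon> \<or> surv N x \<le> 1 - \<delta>"
    if "0 < \<epsilon>" for \<epsilon>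
  proof -
    have "(\<lambda>D. c * \<beta> ^ D) \<longlonglongrightarrow> c * 0"
      using \<beta> by (intro tendsto_intros LIMSEQ_power_zero) simp
    then have "eventually (\<lambda>D. c * \<beta> ^ D < \<epsilon>) sequentially"
      by (rule order_tendstoD) (use that in simp)
    then obtain D where D: "c * \<beta> ^ D < \<epsilon>" by (auto simp: eventually_sequentially)
    obtain N \<delta> where "0 < \<delta>"
      and N: "\<And>y m. y \<in> region_B \<Longrightarrow> fst y - int (snd y) \<le> int D \<Longrightarrow> surv N (y, m) \<le> 1 - \<delta>"
      using surv_uniform[OF P, of D] by blast
    have "norm (h (y, m)) \<le> \<epsilon> \<or> surv N (y, m) \<le> 1 - \<delta>" if y: "y \<in> region_B" for y m
    proof (cases "fst y - int (snd y) \<le> int D")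
      case False
      then have "c * \<beta> ^ nat (fst y - int (snd y)) \<le> c * \<beta> ^ D"
        using c \<beta> by (intro mult_left_mono power_decreasing) auto
      then show ?thesis using decay[OF y, of m] D by linarith
    qed (use N y in blast)
    then show ?thesis using \<open>0 < \<delta>\<close> by (metis prod.collapse)
  qed
  show ?thesis
    unfolding bd_B_determined_def
  proof (intro exI allI impI)
    fix y :: "int \<times> nat" and m :: 'm assume "y \<in> region_B"
    then show "integrable (path_law step (y, m)) (exit_value (\<lambda>x. if fst x \<in> bd_B then h x else 0)) \<and>
      h (y, m) = (\<integral>\<omega>. exit_value (\<lambda>x. if fst x \<in> bd_B then h x else 0) \<omega> \<partial>path_law step (y, m))"
      using harmonic by (intro exit_representation[OF bound c _ small]) (auto simp: YM_harmonic_def)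
  qed
qed

end

section \<open>Harmonicity and decay of product-form functions\<close>

text \<open>Coefficients are attached to indices and not to vectors, so \<open>f\<close> may repeat
  values.\<close>

lemma span_finite_image:
  fixes f :: "'i \<Rightarrow> 'b::real_vector"
  assumes "finite S" "x \<in> span (f ` S)"
  obtains u where "x = (\<Sum>i\<in>S. u i *\<^sub>R f i)"
proof -
  have "\<exists>u. x = (\<Sum>i\<in>S. u i *\<^sub>R f i)"
    using assms
  proof (induction S arbitrary: x)
    case (insert a S)
    then obtain k where "x - k *\<^sub>R f a \<in> span (f ` S)"
      by (auto simp: span_breakdown_eq)
    then obtain u where u: "x - k *\<^sub>R f a = (\<Sum>i\<in>S. u i *\<^sub>R f i)"
      using insert.IH by blast
    have "(\<Sum>i\<in>S. (u(a := k)) i *\<^sub>R f i) = (\<Sum>i\<in>S. u i *\<^sub>R f i)"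
      using insert.hyps by (intro sum.cong) auto
    with u insert.hyps have "x = (\<Sum>i\<in>insert a S. (u(a := k)) i *\<^sub>R f i)"
      by (simp add: algebra_simps)
    then show ?case by blast
  qed simp
  with that show ?thesis by blast
qed

lemma A_mat_of_real:
  assumes "A_mat P lam \<mu>\<^sub>1 \<mu>\<^sub>2 \<beta> \<alpha> *v d = d"
  shows "A_mat P lam \<mu>\<^sub>1 \<mu>\<^sub>2 (complex_of_real \<beta>) (complex_of_real \<alpha>) *v of_real_vec d = of_real_vec d"
proof -
  have "A_mat P lam \<mu>\<^sub>1 \<mu>\<^sub>2 (complex_of_real \<beta>) (complex_of_real \<alpha>) *v of_real_vec d =
      of_real_vec (A_mat P lam \<mu>\<^sub>1 \<mu>\<^sub>2 \<beta> \<alpha> *v d)"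
    by (auto simp: vec_eq_iff matrix_vector_mult_def of_real_vec_def A_mat_def intro!: sum.cong)
  with assms show ?thesis by simp
qed

lemma exit_value_sum:
  "exit_value (\<lambda>x. \<Sum>j\<in>S. a j * f j x) \<omega> = (\<Sum>j\<in>S. a j * exit_value (f j) \<omega>)"
  by (simp add: exit_value_def)

text \<open>On each path \<open>exit_value\<close> is linear in the boundary data, also when the
  path never exits and the value is 0. The data are therefore combined with the same
  coefficients.\<close>

lemma bd_B_determined_sum:
  assumes "\<And>j. j \<in> S \<Longrightarrow> bd_B_determined P lam \<mu>\<^sub>1 \<mu>\<^sub>2 (h j)"
  shows "bd_B_determined P lam \<mu>\<^sub>1 \<mu>\<^sub>2 (\<lambda>x. \<Sum>j\<in>S. a j * h j x)"
proof -
  let ?P = "\<lambda>y m. path_law (YM_step P lam \<mu>\<^sub>1 \<mu>\<^sub>2) (y, m)"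
  from assms have "\<forall>j\<in>S. \<exists>f. \<forall>y m. y \<in> region_B \<longrightarrow> integrable (?P y m) (exit_value f) \<and>
      h j (y, m) = (\<integral>\<omega>. exit_value f \<omega> \<partial>?P y m)"
    unfolding bd_B_determined_def by blast
  then obtain f where f: "\<And>j y m. j \<in> S \<Longrightarrow> y \<in> region_B \<Longrightarrow> integrable (?P y m) (exit_value (f j))"
      "\<And>j y m. j \<in> S \<Longrightarrow> y \<in> region_B \<Longrightarrow> h j (y, m) = (\<integral>\<omega>. exit_value (f j) \<omega> \<partial>?P y m)"
    by (metis (no_types, lifting) bchoice)
  have ev: "exit_value (\<lambda>x. \<Sum>j\<in>S. a j * f j x) = (\<lambda>\<omega>. \<Sum>j\<in>S. a j * exit_value (f j) \<omega>)"
    by (rule ext) (rule exit_value_sum)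
  show ?thesis
    unfolding bd_B_determined_def
    by (rule exI[of _ "\<lambda>x. \<Sum>j\<in>S. a j * f j x"]) (simp add: ev f Bochner_Integration.integral_sum)
qed

context modulated_walk
begin

lemma YM_harmonic_sum:
  assumes "\<And>j. j \<in> S \<Longrightarrow> YM_harmonic P lam \<mu>\<^sub>1 \<mu>\<^sub>2 (h j)"
  shows "YM_harmonic P lam \<mu>\<^sub>1 \<mu>\<^sub>2 (\<lambda>x. \<Sum>j\<in>S. a j * h j x)"
proof -
  have "measure_pmf.expectation (step x) (h j) = h j x" if "j \<in> S" for j x
    using assms[OF that] unfolding YM_harmonic_def by blast
  then show ?thesis
    unfolding YM_harmonic_def by (auto simp del: YM_step.simps simp: Bochner_Integration.integral_sum)
qed

text \<open>The three increments multiply the weight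
  \<open>\<beta> powi (y(1) - y(2)) * \<alpha> ^ y(2)\<close> by 1/\<beta>, \<alpha> and
  \<beta>/\<alpha>, the factors on the diagonal of \<open>A_mat\<close>; the eigenvector equation is
  thus harmonicity off the line \<open>y(2) = 0\<close>. On that line the blocked increment (0, -1)
  has factor 1 instead of \<beta>/\<alpha>, and the difference is the \<open>c_vec\<close>
  term.\<close>

lemma expectation_bracket:
  assumes \<beta>: "\<beta> \<noteq> 0" and \<alpha>: "\<alpha> \<noteq> 0"
    and d: "A_mat P lam \<mu>\<^sub>1 \<mu>\<^sub>2 \<beta> \<alpha> *v of_real_vec d = of_real_vec d"
  shows "measure_pmf.expectation (step (y, m)) (bracket \<beta> \<alpha> d) = bracket \<beta> \<alpha> d (y, m) +
    (if snd y = 0 then \<beta> powi fst y * c_vec P \<mu>\<^sub>2 \<beta> \<alpha> (of_real_vec d) $ m else 0)"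
proof -
  define w where "w = \<beta> powi (fst y - int (snd y)) * \<alpha> ^ snd y"
  let ?dm = "complex_of_real (d $ m)"
  let ?S = "\<Sum>m'\<in>UNIV - {m}. of_real (P $ m $ m') * complex_of_real (d $ m')"
  have "(A_mat P lam \<mu>\<^sub>1 \<mu>\<^sub>2 \<beta> \<alpha> *v of_real_vec d) $ m = ?S +
      of_real (P $ m $ m) * (of_real (lam m) / \<beta> + of_real (\<mu>\<^sub>1 m) * \<alpha> + of_real (\<mu>\<^sub>2 m) * \<beta> / \<alpha>) * ?dm"
    unfolding matrix_vector_mult_def
    by (simp add: sum.remove[of UNIV m] A_mat_def of_real_vec_def)
  with d have eigen: "?S + of_real (P $ m $ m) *
      (of_real (lam m) / \<beta> + of_real (\<mu>\<^sub>1 m) * \<alpha> + of_real (\<mu>\<^sub>2 m) * \<beta> / \<alpha>) * ?dm = ?dm"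
    by (simp add: of_real_vec_def)
  have switch: "(\<Sum>m'\<in>UNIV - {m}. P $ m $ m' *\<^sub>R bracket \<beta> \<alpha> d (y, m')) = w * ?S"
    by (simp add: w_def sum_distrib_left scaleR_conv_of_real mult_ac)
  have left: "bracket \<beta> \<alpha> d (move y (-1, 0), m) = w / \<beta> * ?dm"
  proof -
    have "\<beta> powi (fst y - 1 - int (snd y)) = \<beta> powi (fst y - int (snd y)) / \<beta>"
      using \<beta> power_int_diff[of \<beta> "fst y - int (snd y)" 1] by (simp add: algebra_simps)
    then show ?thesis by (simp add: w_def move_def)
  qed
  have up: "bracket \<beta> \<alpha> d (move y (1, 1), m) = w * \<alpha> * ?dm"
    by (simp add: w_def move_def nat_add_distrib)
  have down: "bracket \<beta> \<alpha> d (move y (0, -1), m) = w * (if snd y = 0 then 1 else \<beta> / \<alpha>) * ?dm"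
  proof (cases "snd y")
    case (Suc k)
    have "\<beta> powi (fst y - int k) = \<beta> powi (fst y - int (snd y)) * \<beta>"
      using \<beta> Suc power_int_add_1[of \<beta> "fst y - int (snd y)"] by (simp add: algebra_simps)
    then show ?thesis using Suc \<alpha> by (simp add: w_def move_def)
  qed (simp add: w_def move_def)
  have "measure_pmf.expectation (step (y, m)) (bracket \<beta> \<alpha> d) = w * ?S + of_real (P $ m $ m) *
     (of_real (lam m) * (w / \<beta> * ?dm) + of_real (\<mu>\<^sub>1 m) * (w * \<alpha> * ?dm) +
      of_real (\<mu>\<^sub>2 m) * (w * (if snd y = 0 then 1 else \<beta> / \<alpha>) * ?dm))"
    unfolding expectation_step switch left up down by (simp add: scaleR_conv_of_real)
  also have "\<dots> = w * (?S + of_real (P $ m $ m) *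
      (of_real (lam m) / \<beta> + of_real (\<mu>\<^sub>1 m) * \<alpha> + of_real (\<mu>\<^sub>2 m) * \<beta> / \<alpha>) * ?dm) +
      (if snd y = 0 then w * of_real (P $ m $ m) * of_real (\<mu>\<^sub>2 m) * ?dm * (1 - \<beta> / \<alpha>) else 0)"
    by (simp add: algebra_simps)
  also have "\<dots> = bracket \<beta> \<alpha> d (y, m) +
    (if snd y = 0 then \<beta> powi fst y * c_vec P \<mu>\<^sub>2 \<beta> \<alpha> (of_real_vec d) $ m else 0)"
    unfolding eigen by (cases y) (simp add: w_def c_vec_def of_real_vec_def mult_ac)
  finally show ?thesis .
qed

lemma YM_harmonic_bracket_sum:
  assumes \<beta>: "\<beta> \<noteq> 0"
    and d: "A_mat P lam \<mu>\<^sub>1 \<mu>\<^sub>2 \<beta> 1 *v d = d"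
    and e: "\<And>l. l \<in> {1..n} \<Longrightarrow> \<alpha> l \<noteq> 0"
      "\<And>l. l \<in> {1..n} \<Longrightarrow> A_mat P lam \<mu>\<^sub>1 \<mu>\<^sub>2 (of_real \<beta>) (\<alpha> l) *v of_real_vec (e l) = of_real_vec (e l)"
    and c: "c_vec P \<mu>\<^sub>2 (of_real \<beta>) 1 (of_real_vec d) +
      (\<Sum>l=1..n. b l *\<^sub>R c_vec P \<mu>\<^sub>2 (of_real \<beta>) (\<alpha> l) (of_real_vec (e l))) = 0"
  shows "YM_harmonic P lam \<mu>\<^sub>1 \<mu>\<^sub>2 (bracket_sum \<beta> d n b \<alpha> e)"
proof -
  have "measure_pmf.expectation (step (y, m)) (bracket_sum \<beta> d n b \<alpha> e) = bracket_sum \<beta> d n b \<alpha> e (y, m)" for y m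
  proof -
    let ?\<beta> = "complex_of_real \<beta>"
    let ?c = "\<lambda>\<alpha> d. c_vec P \<mu>\<^sub>2 ?\<beta> \<alpha> (of_real_vec d) $ m"
    \<comment> \<open>The factor common to the boundary errors of all terms, which depends on
      \<beta> but not on the second parameter.\<close>
    let ?k = "if snd y = 0 then ?\<beta> powi fst y else 0"
    have d': "measure_pmf.expectation (step (y, m)) (bracket ?\<beta> 1 d) = bracket ?\<beta> 1 d (y, m) + ?k * ?c 1 d"
      using expectation_bracket[of ?\<beta> 1 d y m] A_mat_of_real[OF d] \<beta> by simp
    have e': "measure_pmf.expectation (step (y, m)) (bracket ?\<beta> (\<alpha> l) (e l)) =
        bracket ?\<beta> (\<alpha> l) (e l) (y, m) + ?k * ?c (\<alpha> l) (e l)" if "l \<in> {1..n}" for l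
      using expectation_bracket[of ?\<beta> "\<alpha> l" "e l" y m] e that \<beta> by simp
    have "measure_pmf.expectation (step (y, m)) (bracket_sum \<beta> d n b \<alpha> e) =
        measure_pmf.expectation (step (y, m)) (bracket ?\<beta> 1 d) +
        (\<Sum>l=1..n. of_real (b l) * measure_pmf.expectation (step (y, m)) (bracket ?\<beta> (\<alpha> l) (e l)))"
      unfolding bracket_sum_def by (simp del: YM_step.simps add: Bochner_Integration.integral_sum)
    also have "\<dots> = bracket ?\<beta> 1 d (y, m) + ?k * ?c 1 d +
        (\<Sum>l=1..n. of_real (b l) * (bracket ?\<beta> (\<alpha> l) (e l) (y, m) + ?k * ?c (\<alpha> l) (e l)))"
      unfolding d' by (simp only: e' cong: sum.cong)
    also have "\<dots> = bracket_sum \<beta> d n b \<alpha> e (y, m) +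
        ?k * (?c 1 d + (\<Sum>l=1..n. of_real (b l) * ?c (\<alpha> l) (e l)))"
      unfolding bracket_sum_def
      by (simp only: distrib_left sum.distrib sum_distrib_left mult_ac add_ac)
    also have "?c 1 d + (\<Sum>l=1..n. of_real (b l) * ?c (\<alpha> l) (e l)) = 0"
      using arg_cong[OF c, of "\<lambda>v. v $ m"] by (simp flip: scaleR_conv_of_real)
    finally show ?thesis by simp
  qed
  then show ?thesis
    unfolding YM_harmonic_def by (metis surj_pair)
qed

end

text \<open>In \<open>region_B\<close> the exponent \<open>y(1) - y(2)\<close> is nonnegative, so
  the integer power is an ordinary one. The powers of each \<open>\<alpha> l\<close> have norm at
  most 1, which leaves only the decay in the distance.\<close>

lemma norm_bracket_sum_le:
  assumes \<beta>: "0 < \<beta>" and \<alpha>: "\<And>l. l \<in> {1..n} \<Longrightarrow> norm (\<alpha> l) \<le> 1" and y: "y \<in> region_B"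
  shows "norm (bracket_sum \<beta> d n b \<alpha> e (y, m)) \<le>
    (norm d + (\<Sum>l=1..n. \<bar>b l\<bar> * norm (e l))) * \<beta> ^ nat (fst y - int (snd y))"
proof -
  let ?D = "nat (fst y - int (snd y))"
  have D: "\<beta> powi (fst y - int (snd y)) = \<beta> ^ ?D"
    using y by (simp add: power_int_def region_B_def)
  have bracket: "norm (bracket (of_real \<beta>) a v (y, m)) \<le> norm v * \<beta> ^ ?D" if "norm a \<le> 1" for a and v :: "real^'a"
  proof -
    have "norm (bracket (of_real \<beta>) a v (y, m)) = \<beta> ^ ?D * (norm a ^ snd y * \<bar>v $ m\<bar>)"
      using \<beta> D by (simp add: norm_mult norm_power norm_power_int)
    also have "\<dots> \<le> \<beta> ^ ?D * (1 * norm v)"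
      using \<beta> that by (intro mult_left_mono mult_mono power_le_one component_le_norm_cart) auto
    finally show ?thesis by (simp add: mult.commute)
  qed
  have "norm (\<Sum>l=1..n. of_real (b l) * bracket (of_real \<beta>) (\<alpha> l) (e l) (y, m)) \<le>
      (\<Sum>l=1..n. \<bar>b l\<bar> * (norm (e l) * \<beta> ^ ?D))"
    using \<alpha> by (intro sum_norm_le) (simp del: bracket.simps add: norm_mult mult_left_mono bracket)
  with bracket[of 1 d] have "norm (bracket_sum \<beta> d n b \<alpha> e (y, m)) \<le>
      norm d * \<beta> ^ ?D + (\<Sum>l=1..n. \<bar>b l\<bar> * (norm (e l) * \<beta> ^ ?D))"
    unfolding bracket_sum_def by (intro order_trans[OF norm_triangle_ineq] add_mono) (simp_all del: bracket.simps)
  then show ?thesis by (simp add: distrib_right sum_distrib_right mult.assoc)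
qed

text \<open>On the diagonal the power of \<beta> is 1, and the terms with \<open>\<alpha> l\<close>
  carry a vanishing factor \<open>\<alpha> l ^ k\<close>.\<close>

lemma bracket_sum_diagonal_tendsto:
  assumes "\<And>l. l \<in> {1..n} \<Longrightarrow> norm (\<alpha> l) < 1"
  shows "(\<lambda>k. bracket_sum \<beta> d n b \<alpha> e ((int k, k), m)) \<longlonglongrightarrow> of_real (d $ m)"
proof -
  have "(\<lambda>k. of_real (d $ m) + (\<Sum>l=1..n. of_real (b l) * (\<alpha> l ^ k * complex_of_real (e l $ m))))
      \<longlonglongrightarrow> of_real (d $ m) + (\<Sum>l=1..n. of_real (b l) * (0 * complex_of_real (e l $ m)))"
    using assms by (intro tendsto_intros LIMSEQ_power_zero) auto
  then show ?thesis by (simp add: bracket_sum_def)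
qed

section \<open>Choice of the coefficients, and the limit along the diagonal\<close>

theorem proposition8p1:
  fixes P :: "real^'m::finite^'m"
    and lam \<mu>\<^sub>1 \<mu>\<^sub>2 :: "'m \<Rightarrow> real"
    and \<pi> :: "real^'m"
    and \<rho>\<^sub>1 \<rho>\<^sub>2 :: real
    and d\<^sub>2 :: "real^'m"
    and \<alpha>s :: "nat \<Rightarrow> real"
    and d2 :: "nat \<Rightarrow> real^'m"
    and b21 :: "nat \<Rightarrow> real"
    and r :: "nat \<Rightarrow> real"
    and e :: "nat \<Rightarrow> real^'m"
    and mm :: "nat \<Rightarrow> nat"
    and \<alpha>c :: "nat \<Rightarrow> nat \<Rightarrow> complex"
    and ec :: "nat \<Rightarrow> nat \<Rightarrow> real^'m"
    and h\<^sub>\<rho>\<^sub>2 :: "'m state \<Rightarrow> complex"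
  assumes P: "stochastic P" "irreducible_matrix P" "aperiodic_matrix P" "stationary P \<pi>"
    and rates: "\<And>m. 0 < lam m" "\<And>m. 0 < \<mu>\<^sub>1 m" "\<And>m. 0 < \<mu>\<^sub>2 m" "\<And>m. lam m + \<mu>\<^sub>1 m + \<mu>\<^sub>2 m = 1"
    and stability: "(\<Sum>m\<in>UNIV. (lam m - \<mu>\<^sub>1 m) * \<pi> $ m * P $ m $ m) < 0"
      "(\<Sum>m\<in>UNIV. (lam m - \<mu>\<^sub>2 m) * \<pi> $ m * P $ m $ m) < 0"
    and rho1: "0 < \<rho>\<^sub>1" "\<rho>\<^sub>1 < 1" "Lam P lam \<mu>\<^sub>1 \<mu>\<^sub>2 1 \<rho>\<^sub>1 \<rho>\<^sub>1 = 1"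
    and rho2: "0 < \<rho>\<^sub>2" "\<rho>\<^sub>2 < 1" "Lam P lam \<mu>\<^sub>1 \<mu>\<^sub>2 1 \<rho>\<^sub>2 1 = 1"
    and d_2: "\<And>m. 0 < d\<^sub>2 $ m" "A_mat P lam \<mu>\<^sub>1 \<mu>\<^sub>2 \<rho>\<^sub>2 1 *v d\<^sub>2 = d\<^sub>2"
    and condC: "(\<Sum>m\<in>UNIV. (\<rho>\<^sub>2 * \<mu>\<^sub>2 m - \<mu>\<^sub>1 m) * P $ m $ m *
        det_on (UNIV - {m}) (mat 1 - A_mat P lam \<mu>\<^sub>1 \<mu>\<^sub>2 \<rho>\<^sub>2 1)) < 0"
    and rho_neq: "\<rho>\<^sub>1 \<noteq> \<rho>\<^sub>2"
    and assmE: "\<And>\<beta> \<alpha> :: real. 0 < \<beta> \<Longrightarrow> 0 < \<alpha> \<Longrightarrow>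
        card (real_eigenvalues (A_mat P lam \<mu>\<^sub>1 \<mu>\<^sub>2 \<beta> \<alpha>)) = CARD('m)"
    and alpha1: "0 < \<alpha>s 1" "\<alpha>s 1 < 1" "Lam P lam \<mu>\<^sub>1 \<mu>\<^sub>2 1 \<rho>\<^sub>2 (\<alpha>s 1) = 1"
    and alphaj: "\<And>j. j \<in> {2..CARD('m)} \<Longrightarrow>
        0 < \<alpha>s j \<and> \<alpha>s j < \<alpha>s 1 \<and> Lam P lam \<mu>\<^sub>1 \<mu>\<^sub>2 j \<rho>\<^sub>2 (\<alpha>s j) = 1"
    and d2j: "\<And>j. j \<in> {1..CARD('m)} \<Longrightarrow>
        d2 j \<noteq> 0 \<and> A_mat P lam \<mu>\<^sub>1 \<mu>\<^sub>2 \<rho>\<^sub>2 (\<alpha>s j) *v d2 j = d2 j"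
    and spanS: "c_vec P \<mu>\<^sub>2 \<rho>\<^sub>2 1 d\<^sub>2 \<in> span ((\<lambda>j. c_vec P \<mu>\<^sub>2 \<rho>\<^sub>2 (\<alpha>s j) (d2 j)) ` {1..CARD('m)})"
    and h_rho2: "h\<^sub>\<rho>\<^sub>2 = bracket_sum \<rho>\<^sub>2 d\<^sub>2 CARD('m) b21 (\<lambda>j. of_real (\<alpha>s j)) d2"
      "YM_harmonic P lam \<mu>\<^sub>1 \<mu>\<^sub>2 h\<^sub>\<rho>\<^sub>2" "bd_B_determined P lam \<mu>\<^sub>1 \<mu>\<^sub>2 h\<^sub>\<rho>\<^sub>2"
    and rho2j: "\<And>j. j \<in> {2..CARD('m)} \<Longrightarrow> 0 < r j \<and> r j < \<rho>\<^sub>2"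
      "\<And>i j. i \<in> {2..CARD('m)} \<Longrightarrow> j \<in> {2..CARD('m)} \<Longrightarrow> i < j \<Longrightarrow> r j < r i"
    and ej: "\<And>j. j \<in> {2..CARD('m)} \<Longrightarrow> e j \<noteq> 0 \<and> A_mat P lam \<mu>\<^sub>1 \<mu>\<^sub>2 (r j) 1 *v e j = e j"
    and assmF: "\<And>j. j \<in> {2..CARD('m)} \<Longrightarrow> mm j \<le> CARD('m)"
      "\<And>j l. j \<in> {2..CARD('m)} \<Longrightarrow> l \<in> {1..mm j} \<Longrightarrow>
        conjugate_points P lam \<mu>\<^sub>1 \<mu>\<^sub>2 (of_real (r j)) 1 (\<alpha>c j l) \<and> norm (\<alpha>c j l) < 1 \<and>
        ec j l \<noteq> 0 \<and>
        A_mat P lam \<mu>\<^sub>1 \<mu>\<^sub>2 (of_real (r j)) (\<alpha>c j l) *v of_real_vec (ec j l) = of_real_vec (ec j l)"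
      "\<And>j. j \<in> {2..CARD('m)} \<Longrightarrow>
        c_vec P \<mu>\<^sub>2 (of_real (r j)) 1 (of_real_vec (e j)) \<in>
          span ((\<lambda>l. c_vec P \<mu>\<^sub>2 (of_real (r j)) (\<alpha>c j l) (of_real_vec (ec j l))) ` {1..mm j})"
    and ones: "(\<chi> m. 1) \<in> span (insert d\<^sub>2 (e ` {2..CARD('m)}))"
  shows "\<exists>(b2j :: nat \<Rightarrow> nat \<Rightarrow> real) (b2 :: nat \<Rightarrow> real).
    let h\<^sub>\<rho> = (\<lambda>j. bracket_sum (r j) (e j) (mm j) (b2j j) (\<alpha>c j) (ec j));
        h = (\<lambda>x. of_real (b2 1) * h\<^sub>\<rho>\<^sub>2 x + (\<Sum>j=2..CARD('m). of_real (b2 j) * h\<^sub>\<rho> j x))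
    in (\<forall>j\<in>{2..CARD('m)}. YM_harmonic P lam \<mu>\<^sub>1 \<mu>\<^sub>2 (h\<^sub>\<rho> j) \<and> bd_B_determined P lam \<mu>\<^sub>1 \<mu>\<^sub>2 (h\<^sub>\<rho> j)) \<and>
       YM_harmonic P lam \<mu>\<^sub>1 \<mu>\<^sub>2 h \<and> bd_B_determined P lam \<mu>\<^sub>1 \<mu>\<^sub>2 h \<and>
       (\<forall>m. (\<lambda>k. h ((int k, k), m)) \<longlonglongrightarrow> 1)"
proof -
  interpret modulated_walk P lam \<mu>\<^sub>1 \<mu>\<^sub>2
    by unfold_locales (use P(1) rates in auto)
  let ?n = "CARD('m)"
  \<comment> \<open>If the diagonal of \<open>P\<close> vanished, the sum in the stability condition
    would be zero and not negative.\<close>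
  have "\<exists>m. 0 < P $ m $ m"
  proof (rule ccontr)
    assume "\<nexists>m. 0 < P $ m $ m"
    then have "P $ m $ m = 0" for m using P_nonneg[of m m] by (metis order_le_less)
    with stability(1) show False by simp
  qed
  then obtain m0 where m0: "0 < P $ m0 $ m0" ..

  have "\<exists>b. YM_harmonic P lam \<mu>\<^sub>1 \<mu>\<^sub>2 (bracket_sum (r j) (e j) (mm j) b (\<alpha>c j) (ec j)) \<and>
      bd_B_determined P lam \<mu>\<^sub>1 \<mu>\<^sub>2 (bracket_sum (r j) (e j) (mm j) b (\<alpha>c j) (ec j))"
    if j: "j \<in> {2..?n}" for j
  proof -
    have r: "0 < r j" "r j < 1" using rho2j(1)[OF j] rho2(2) by auto
    \<comment> \<open>The span is taken over the reals, so the coefficients are real even though the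
      vectors are complex, as \<open>bracket_sum\<close> demands.\<close>
    obtain u where u: "c_vec P \<mu>\<^sub>2 (of_real (r j)) 1 (of_real_vec (e j)) =
        (\<Sum>l=1..mm j. u l *\<^sub>R c_vec P \<mu>\<^sub>2 (of_real (r j)) (\<alpha>c j l) (of_real_vec (ec j l)))"
      using span_finite_image[OF _ assmF(3)[OF j]] by blast
    \<comment> \<open>The minus signs make the boundary errors of the conjugate points cancel that
      of the point with second parameter 1.\<close>
    let ?h = "bracket_sum (r j) (e j) (mm j) (\<lambda>l. - u l) (\<alpha>c j) (ec j)"
    have \<alpha>c: "norm (\<alpha>c j l) \<le> 1" if "l \<in> {1..mm j}" for l
      using assmF(2)[OF j that] by simp
    have harmonic: "YM_harmonic P lam \<mu>\<^sub>1 \<mu>\<^sub>2 ?h"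
    proof (rule YM_harmonic_bracket_sum)
      show "r j \<noteq> 0" using r by simp
      show "A_mat P lam \<mu>\<^sub>1 \<mu>\<^sub>2 (r j) 1 *v e j = e j" using ej[OF j] by simp
      show "\<alpha>c j l \<noteq> 0" if "l \<in> {1..mm j}" for l
        using assmF(2)[OF j that] by (simp add: conjugate_points_def)
      show "A_mat P lam \<mu>\<^sub>1 \<mu>\<^sub>2 (of_real (r j)) (\<alpha>c j l) *v of_real_vec (ec j l) = of_real_vec (ec j l)"
        if "l \<in> {1..mm j}" for l
        using assmF(2)[OF j that] by simp
      show "c_vec P \<mu>\<^sub>2 (of_real (r j)) 1 (of_real_vec (e j)) + (\<Sum>l=1..mm j. - u l *\<^sub>R
          c_vec P \<mu>\<^sub>2 (of_real (r j)) (\<alpha>c j l) (of_real_vec (ec j l))) = 0"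
        unfolding u by (simp add: sum_negf)
    qed
    moreover have "bd_B_determined P lam \<mu>\<^sub>1 \<mu>\<^sub>2 ?h"
      by (rule bd_B_determinedI[OF P(2) m0 harmonic r norm_bracket_sum_le[OF r(1) \<alpha>c]])
    ultimately show ?thesis by blast
  qed
  then obtain b2j where b2j: "\<And>j. j \<in> {2..?n} \<Longrightarrow>
      YM_harmonic P lam \<mu>\<^sub>1 \<mu>\<^sub>2 (bracket_sum (r j) (e j) (mm j) (b2j j) (\<alpha>c j) (ec j)) \<and>
      bd_B_determined P lam \<mu>\<^sub>1 \<mu>\<^sub>2 (bracket_sum (r j) (e j) (mm j) (b2j j) (\<alpha>c j) (ec j))"
    by metis

  \<comment> \<open>Splitting off the vector \<open>d\<^sub>2\<close> separates the weight
    \<open>k\<close> of \<open>h\<^sub>\<rho>\<^sub>2\<close> from the weights \<open>u j\<close> of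
    the other functions.\<close>
  obtain k where "(\<chi> m. 1) - k *\<^sub>R d\<^sub>2 \<in> span (e ` {2..?n})"
    using ones by (auto simp: span_breakdown_eq)
  then obtain u where u: "(\<chi> m. 1) - k *\<^sub>R d\<^sub>2 = (\<Sum>j=2..?n. u j *\<^sub>R e j)"
    using span_finite_image[of "{2..?n}"] by blast
  have one: "k * d\<^sub>2 $ m + (\<Sum>j=2..?n. u j * e j $ m) = 1" for m
    using arg_cong[OF u, of "\<lambda>v. v $ m"] by simp

  define h\<^sub>\<rho> where "h\<^sub>\<rho> = (\<lambda>j. bracket_sum (r j) (e j) (mm j) (b2j j) (\<alpha>c j) (ec j))"
  \<comment> \<open>The sum representing the all-ones vector uses \<open>u\<close> only at indices
    from 2 on, so entry 1 is free to hold \<open>k\<close>.\<close>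
  define b2 where "b2 = u(1 := k)"
  define h where "h = (\<lambda>x. of_real (b2 1) * h\<^sub>\<rho>\<^sub>2 x + (\<Sum>j=2..?n. of_real (b2 j) * h\<^sub>\<rho> j x))"
  \<comment> \<open>With \<open>h\<^sub>\<rho>\<^sub>2\<close> placed at index 1, \<open>h\<close>
    is a single sum to which closure under linear combinations applies.\<close>
  let ?H = "h\<^sub>\<rho>(1 := h\<^sub>\<rho>\<^sub>2)"
  have h_sum: "h = (\<lambda>x. \<Sum>j=1..?n. of_real (b2 j) * ?H j x)"
  proof
    fix x
    have "{1..?n} = insert 1 {2..?n}" by auto
    then have "(\<Sum>j=1..?n. of_real (b2 j) * ?H j x) = of_real (b2 1) * ?H 1 x + (\<Sum>j=2..?n. of_real (b2 j) * ?H j x)"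
      by simp
    also have "(\<Sum>j=2..?n. of_real (b2 j) * ?H j x) = (\<Sum>j=2..?n. of_real (b2 j) * h\<^sub>\<rho> j x)"
      by (intro sum.cong) auto
    finally show "h x = (\<Sum>j=1..?n. of_real (b2 j) * ?H j x)" by (simp add: h_def)
  qed
  have H: "YM_harmonic P lam \<mu>\<^sub>1 \<mu>\<^sub>2 (?H j)" "bd_B_determined P lam \<mu>\<^sub>1 \<mu>\<^sub>2 (?H j)" if "j \<in> {1..?n}" for j
    using b2j[of j] h_rho2(2,3) that by (auto simp: h\<^sub>\<rho>_def)
  have "YM_harmonic P lam \<mu>\<^sub>1 \<mu>\<^sub>2 h"
    unfolding h_sum by (rule YM_harmonic_sum) (rule H)
  moreover have "bd_B_determined P lam \<mu>\<^sub>1 \<mu>\<^sub>2 h"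
    unfolding h_sum by (rule bd_B_determined_sum) (rule H)
  moreover have "(\<lambda>k. h ((int k, k), m)) \<longlonglongrightarrow> 1" for m
  proof -
    \<comment> \<open>For indices from 2 on, \<open>\<alpha>s j\<close> lies between 0 and
      \<open>\<alpha>s 1\<close>, which is itself below 1.\<close>
    have "norm (complex_of_real (\<alpha>s j)) < 1" if "j \<in> {1..?n}" for j
      using alpha1(1,2) alphaj[of j] that by (cases "j = 1") auto
    then have lim1: "(\<lambda>k. h\<^sub>\<rho>\<^sub>2 ((int k, k), m)) \<longlonglongrightarrow> of_real (d\<^sub>2 $ m)"
      unfolding h_rho2(1) by (rule bracket_sum_diagonal_tendsto)
    have lim2: "(\<lambda>k. h\<^sub>\<rho> j ((int k, k), m)) \<longlonglongrightarrow> of_real (e j $ m)" if "j \<in> {2..?n}" for j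
      unfolding h\<^sub>\<rho>_def by (rule bracket_sum_diagonal_tendsto) (use assmF(2)[OF that] in blast)
    have "(\<lambda>k. h ((int k, k), m)) \<longlonglongrightarrow>
        of_real (b2 1) * of_real (d\<^sub>2 $ m) + (\<Sum>j=2..?n. of_real (b2 j) * of_real (e j $ m))"
      unfolding h_def by (intro tendsto_intros lim1 lim2)
    also have "of_real (b2 1) * of_real (d\<^sub>2 $ m) + (\<Sum>j=2..?n. of_real (b2 j) * of_real (e j $ m)) =
        complex_of_real (k * d\<^sub>2 $ m + (\<Sum>j=2..?n. u j * e j $ m))"
      by (simp add: b2_def)
    finally show ?thesis by (simp only: one of_real_1)
  qed
  ultimately show ?thesis
    using b2j unfolding Let_def h_def h\<^sub>\<rho>_def by blast
qed

end
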